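(* Let $\alpha>\beta$ and $\tau>0$ be constants, and let $G_n\sim \mathrm{SBM}(n,\mu_1,\mu_2,\tau^2)$ with $\mu_1=\alpha\sqrt{\frac{\log n}{n}}$, $\mu_2=\beta\sqrt{\frac{\log n}{n}}$ and planted labeling $\sigma^*\in\Theta_n$; put $Y^*=\sigma^*\sigma^{*\top}$. Let $\mathrm{SNR}=\frac{(\alpha-\beta)^2}{8\tau^2}$. If $\mathrm{SNR}>1$, then $$\min_{Y^*\in\mathcal Y_n}\mathbb{P}\left\{\hat Y_{\mathrm{SDP}}=Y^*\right\}\to 1\quad\text{as } n\to\infty .$$
   Context: $n$ is even, $[n]=\{1,\dots,n\}$, and $\Theta_n=\{\sigma\in\{\pm1\}^n:\sum_i\sigma_i=0\}$. Gaussian weighted stochastic block model $\mathrm{SBM}(n,\mu_1,\mu_2,\tau^2)$: given a planted (unobserved) labeling $\sigma^*\in\Theta_n$, the observed symmetric weighted adjacency matrix $A=(A_{ij})_{i,j\in[n]}$ has $A_{ii}=0$, and, independently over unordered pairs $\{i,j\}$ with $i\ne j$, $A_{ij}=A_{ji}\sim N(\mu_1,\tau^2)$ if $\sigma^*_i=\sigma^*_j$ and $A_{ij}=A_{ji}\sim N(\mu_2,\tau^2)$ if $\sigma^*_i\neq\sigma^*_j$. $\mathcal Y_n=\{\sigma\sigma^\top:\sigma\in\Theta_n\}$. For $Y^*=\sigma^*\sigma^{*\top}\in\mathcal Y_n$, the probability $\mathbb P\{\hat Y_{\mathrm{SDP}}=Y^*\}$ is computed under the model with planted labeling $\sigma^*$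 (the law depends only on $\pm\sigma^*$). $\langle X,Y\rangle=\mathrm{Tr}(X^\top Y)$, and $\mathbf J$ is the $n\times n$ all-ones matrix. The semidefinite programming estimator $\hat Y_{\mathrm{SDP}}$ is a maximizer of $\langle A,Y\rangle$ over symmetric real $n\times n$ matrices $Y$ with $Y\succeq0$, $Y_{ii}=1$ for all $i\in[n]$, and $\langle\mathbf J,Y\rangle=0$. *)

theory Defs
  imports "HOL-Probability.Probability" "Jordan_Normal_Form.Matrix"
begin

unbundle no vec_syntax
unbundle no inner_syntax

text \<open>
  Vertices are \<open>0, \<dots>, n - 1\<close>. Vectors and matrices are those of Jordan_Normal_Form, whose
  dimension is part of the value, since \<open>n\<close> tends to infinity.
\<close>

definition balanced_labelings :: "nat \<Rightarrow> real vec set" where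
  "balanced_labelings n =
     {\<sigma> \<in> carrier_vec n. (\<forall>i<n. \<sigma> $ i \<in> {-1, 1}) \<and> (\<Sum>i<n. \<sigma> $ i) = 0}"

definition label_matrix :: "real vec \<Rightarrow> real mat" where
  "label_matrix \<sigma> = mat (dim_vec \<sigma>) (dim_vec \<sigma>) (\<lambda>(i, j). \<sigma> $ i * \<sigma> $ j)"

definition label_matrices :: "nat \<Rightarrow> real mat set" where
  "label_matrices n = label_matrix ` balanced_labelings n"

text \<open>
  The sample space of the weighted stochastic block model consists of the edge weights
  \<open>\<omega> (i, j)\<close> for \<open>i < j < n\<close>, one for each unordered pair of distinct vertices; the product
  measure makes them independent. The second parameter of \<open>normal_density\<close> is the standard
  deviation, so a weight has variance \<open>\<tau>\<^sup>2\<close>.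
\<close>

definition SBM :: "nat \<Rightarrow> real \<Rightarrow> real \<Rightarrow> real \<Rightarrow> real vec \<Rightarrow> (nat \<times> nat \<Rightarrow> real) measure" where
  "SBM n \<mu>1 \<mu>2 \<tau> \<sigma> =
     (\<Pi>\<^sub>M (i, j) \<in> {(i, j). i < j \<and> j < n}.
        density lborel (\<lambda>x. ennreal (normal_density (if \<sigma> $ i = \<sigma> $ j then \<mu>1 else \<mu>2) \<tau> x)))"

definition adjacency_matrix :: "nat \<Rightarrow> (nat \<times> nat \<Rightarrow> real) \<Rightarrow> real mat" where
  "adjacency_matrix n \<omega> =
     mat n n (\<lambda>(i, j). if i = j then 0 else \<omega> (min i j, max i j))"

definition mat_trace :: "real mat \<Rightarrow> real" where
  "mat_trace M = (\<Sum>i<dim_row M. M $$ (i, i))"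

definition mat_inner :: "real mat \<Rightarrow> real mat \<Rightarrow> real" where
  "mat_inner X Y = mat_trace (transpose_mat X * Y)"

definition all_ones_mat :: "nat \<Rightarrow> real mat" where
  "all_ones_mat n = mat n n (\<lambda>_. 1)"

definition symmetric_mat :: "real mat \<Rightarrow> bool" where
  "symmetric_mat M \<longleftrightarrow> transpose_mat M = M"

definition pos_semidef :: "nat \<Rightarrow> real mat \<Rightarrow> bool" where
  "pos_semidef n M \<longleftrightarrow>
     M \<in> carrier_mat n n \<and> symmetric_mat M \<and> (\<forall>v \<in> carrier_vec n. 0 \<le> v \<bullet> (M *\<^sub>v v))"

definition sdp_feasible :: "nat \<Rightarrow> real mat \<Rightarrow> bool" where
  "sdp_feasible n Y \<longleftrightarrow>
     pos_semidef n Y \<and> (\<forall>i<n. Y $$ (i, i) = 1) \<and> mat_inner (all_ones_mat n) Y = 0"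

text \<open>
  An estimator is a function of the observed matrix alone; maximizers of the semidefinite
  program need not be unique, so any choice of them is allowed. For odd \<open>n\<close> there are no
  balanced labelings (and for \<open>n = 1\<close> no feasible point), so only even \<open>n\<close> is constrained.
\<close>

definition sdp_estimator :: "(nat \<Rightarrow> real mat \<Rightarrow> real mat) \<Rightarrow> bool" where
  "sdp_estimator Yhat \<longleftrightarrow>
     (\<forall>n A. even n \<longrightarrow> A \<in> carrier_mat n n \<longrightarrow> symmetric_mat A \<longrightarrow>
        is_arg_max (mat_inner A) (sdp_feasible n) (Yhat n A))"

definition recovery_event ::
    "(nat \<Rightarrow> real mat \<Rightarrow> real mat) \<Rightarrow> nat \<Rightarrow> real mat \<Rightarrow> (nat \<times> nat \<Rightarrow> real) measure
       \<Rightarrow> (nat \<times> nat \<Rightarrow> real) set" where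
  "recovery_event Yhat n Y M = {\<omega> \<in> space M. Yhat n (adjacency_matrix n \<omega>) = Y}"

end

theory Submission
  imports Defs "HOL-Real_Asymp.Real_Asymp"
begin

text \<open>
  Write \<open>h = (\<mu>1 - \<mu>2) / 2\<close> and let \<open>W\<close> be the centred noise \<open>A - E A\<close>. The semidefinite program
  recovers \<open>Y* = \<sigma> \<sigma>\<^sup>T\<close> as soon as the maxima of two quantities add up to less than \<open>n h\<close>: the signed
  row sums \<open>r i = - (\<Sum>j. W i j * \<sigma> i * \<sigma> j)\<close> and the quadratic form of \<open>W\<close> on unit vectors.

  The deterministic part is a dual certificate. Put \<open>d i = (\<Sum>j. A i j * \<sigma> i * \<sigma> j)\<close>. The form
  \<open>Q x = (\<Sum>i. d i * (x i)\<^sup>2) - x\<^sup>T A x\<close> annihilates \<open>\<sigma>\<close>, and if \<open>r i \<le> a\<close> for all \<open>i\<close> and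
  \<open>x\<^sup>T W x \<le> b |x|\<^sup>2\<close>, then on vectors orthogonal to the all-ones vector it is at least \<open>n h - a - b\<close>
  times the squared distance to the line spanned by \<open>\<sigma>\<close> (\<open>laplacian_lower_bound\<close>). A feasible \<open>Y\<close> is
  a Gram matrix, that is, a sum of squares \<open>v k (v k)\<^sup>T\<close> (\<open>psd_gram\<close>), and \<open>\<langle>J, Y\<rangle> = 0\<close> forces all
  \<open>v k\<close> to be orthogonal to the all-ones vector. Summing \<open>Q (v k)\<close> over \<open>k\<close> compares \<open>\<langle>A, Y\<rangle>\<close> with
  \<open>\<langle>A, Y*\<rangle>\<close> and shows that a maximizer has overlap \<open>\<langle>Y*, Y\<rangle> = n\<^sup>2\<close>, which leaves only \<open>Y = Y*\<close>
  (\<open>dual_certificate\<close>).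

  For the probabilistic part let \<open>s = sqrt (n ln n)\<close>, so that \<open>n h = (\<alpha> - \<beta>) / 2 * s\<close>. Both
  quantities are controlled by the Chernoff bound for linear forms of independent Gaussian variables
  (\<open>gaussian_linear_tail\<close>). A row sum has variance at most \<open>n \<tau>\<^sup>2\<close>, so it exceeds \<open>\<gamma> s\<close> with
  probability at most \<open>n powr (- \<gamma>\<^sup>2 / (2 \<tau>\<^sup>2))\<close>; a union bound over the \<open>n\<close> rows succeeds exactly
  when \<open>\<gamma> > sqrt 2 * \<tau>\<close>. The condition on the signal-to-noise ratio says that
  \<open>(\<alpha> - \<beta>) / 2 > sqrt 2 * \<tau>\<close>, hence such a \<open>\<gamma>\<close> fits below \<open>(\<alpha> - \<beta>) / 2\<close>, with a positive
  multiple \<open>\<eta> s\<close> of \<open>s\<close> left for the noise form. The latter is of order \<open>sqrt n\<close> only, so a crude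
  union bound over pairs from a net of at most \<open>48 ^ n\<close> points suffices: the failure probability is
  \<open>exp (O(n) - c n ln n)\<close>. The net consists of lattice points, which are counted with a
  generating function (\<open>card_net\<close>).
\<close>

section \<open>Gram vectors of positive semidefinite forms\<close>

definition bilinear_form ::
    "nat \<Rightarrow> (nat \<Rightarrow> nat \<Rightarrow> real) \<Rightarrow> (nat \<Rightarrow> real) \<Rightarrow> (nat \<Rightarrow> real) \<Rightarrow> real" where
  "bilinear_form n W x y = (\<Sum>i<n. \<Sum>j<n. x i * W i j * y j)"

lemma bilinear_form_add_left:
  "bilinear_form n W (\<lambda>i. x i + x' i) y = bilinear_form n W x y + bilinear_form n W x' y"
  unfolding bilinear_form_def by (simp add: algebra_simps sum.distrib)

lemma bilinear_form_add_right:
  "bilinear_form n W x (\<lambda>i. y i + y' i) = bilinear_form n W x y + bilinear_form n W x y'"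
  unfolding bilinear_form_def by (simp add: algebra_simps sum.distrib)

lemma bilinear_form_scale:
  "bilinear_form n W (\<lambda>i. c * x i) (\<lambda>i. d * y i) = c * d * bilinear_form n W x y"
  unfolding bilinear_form_def by (simp add: sum_distrib_left mult_ac)

lemma bilinear_form_Suc:
  assumes "\<And>i. i < n \<Longrightarrow> Y n i = Y i n"
  shows "bilinear_form (Suc n) Y x x =
    bilinear_form n Y x x + 2 * x n * (\<Sum>i<n. x i * Y i n) + Y n n * (x n)\<^sup>2"
proof -
  have "(\<Sum>j<n. x n * Y n j * x j) = x n * (\<Sum>i<n. x i * Y i n)"
    unfolding sum_distrib_left by (intro sum.cong) (auto simp: assms)
  moreover have "(\<Sum>i<n. x i * Y i n * x n) = x n * (\<Sum>i<n. x i * Y i n)"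
    unfolding sum_distrib_left by (intro sum.cong) auto
  ultimately show ?thesis
    unfolding bilinear_form_def by (simp add: sum.distrib power2_eq_square algebra_simps)
qed

lemma bilinear_form_point:
  assumes "k < n"
  shows "bilinear_form n Y (\<lambda>i. if i = k then t else 0) (\<lambda>i. if i = k then t else 0) = Y k k * t\<^sup>2"
proof -
  have "(\<Sum>j<n. (if i = k then t else 0) * Y i j * (if j = k then t else 0))
      = (if i = k then Y k k * t\<^sup>2 else 0)" for i
    using assms by (simp add: if_distrib[of "\<lambda>z. _ * z"] power2_eq_square cong: if_cong)
  then show ?thesis
    using assms unfolding bilinear_form_def by simp
qed

text \<open>
  Cholesky factorization by induction on the dimension: the last column \<open>Y i n / sqrt (Y n n)\<close> is one
  of the factors, and subtracting its square leaves a form on the first \<open>n\<close> coordinates (the Schur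
  complement), which is again positive semidefinite because its value at \<open>x\<close> is that of \<open>Y\<close> at the best
  extension of \<open>x\<close> by a last coordinate.
\<close>

lemma psd_gram:
  fixes Y :: "nat \<Rightarrow> nat \<Rightarrow> real"
  assumes "\<And>i j. i < n \<Longrightarrow> j < n \<Longrightarrow> Y i j = Y j i"
    and "\<And>x. 0 \<le> bilinear_form n Y x x"
  shows "\<exists>v. \<forall>i<n. \<forall>j<n. Y i j = (\<Sum>k<n. v k i * v k j)"
  using assms
proof (induction n arbitrary: Y)
  case 0
  then show ?case by simp
next
  case (Suc n)
  have sym: "\<And>i. i < n \<Longrightarrow> Y n i = Y i n" using Suc.prems(1) by simp
  have expand: "bilinear_form (Suc n) Y x x =
      bilinear_form n Y x x + 2 * x n * (\<Sum>i<n. x i * Y i n) + Y n n * (x n)\<^sup>2" for x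
    by (rule bilinear_form_Suc) (rule sym)
  define a where "a = Y n n"
  have a0: "0 \<le> a"
    using Suc.prems(2)[of "\<lambda>i. if i = n then 1 else 0"]
    unfolding a_def by (subst (asm) bilinear_form_point) auto
  have zero_column: "Y i n = 0" if "a = 0" "i < n" for i
  proof (rule ccontr)
    assume ne: "Y i n \<noteq> 0"
    define c d where "c = Y i n" and "d = Y i i"
    \<comment> \<open>Along \<open>(t, 1)\<close> in the coordinates \<open>i\<close> and \<open>n\<close> the form is \<open>d t\<^sup>2 + 2 c t\<close>, which is negative
      for small \<open>t\<close> of the sign opposite to \<open>c\<close>.\<close>
    define t where "t = - c / (d + 1)"
    have d0: "0 \<le> d"
      using Suc.prems(2)[of "\<lambda>k. if k = i then 1 else 0"] that
      unfolding d_def by (subst (asm) bilinear_form_point) auto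
    define x where "x = (\<lambda>k. if k = n then 1 else if k = i then t else 0)"
    have "bilinear_form n Y x x
        = bilinear_form n Y (\<lambda>k. if k = i then t else 0) (\<lambda>k. if k = i then t else 0)"
      unfolding bilinear_form_def x_def by (intro sum.cong) auto
    then have 1: "bilinear_form n Y x x = d * t\<^sup>2"
      using that by (simp add: bilinear_form_point d_def)
    have "(\<Sum>k<n. x k * Y k n) = (\<Sum>k<n. if k = i then t * c else 0)"
      unfolding x_def c_def by (intro sum.cong) auto
    then have 2: "(\<Sum>k<n. x k * Y k n) = t * c" using that by simp
    have "0 \<le> d * t\<^sup>2 + 2 * (t * c)"
      using Suc.prems(2)[of x] that unfolding expand 1 2 by (simp add: x_def a_def)
    also have "d * t\<^sup>2 + 2 * (t * c) = - (c\<^sup>2 * (d + 2)) / (d + 1)\<^sup>2"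
      using d0 unfolding t_def by (simp add: divide_simps power2_eq_square) (simp add: algebra_simps)
    also have "\<dots> < 0" using ne d0 by (simp add: c_def)
    finally show False by simp
  qed
  \<comment> \<open>If \<open>a = 0\<close>, division by zero gives \<open>Z = Y\<close>, and the last column of \<open>Y\<close> vanishes by
    \<open>zero_column\<close>, so both cases can be treated together.\<close>
  define Z where "Z = (\<lambda>i j. Y i j - Y i n * Y j n / a)"
  have "\<exists>v. \<forall>i<n. \<forall>j<n. Z i j = (\<Sum>k<n. v k i * v k j)"
  proof (rule Suc.IH)
    show "\<And>i j. i < n \<Longrightarrow> j < n \<Longrightarrow> Z i j = Z j i"
      using Suc.prems(1) unfolding Z_def by simp
    fix x :: "nat \<Rightarrow> real"
    define b where "b = (\<Sum>i<n. x i * Y i n)"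
    \<comment> \<open>For \<open>a > 0\<close> this last coordinate minimizes the form of \<open>Y\<close>.\<close>
    define x' where "x' = x(n := - b / a)"
    have 1: "bilinear_form n Y x' x' = bilinear_form n Y x x"
      unfolding bilinear_form_def x'_def by (intro sum.cong) auto
    have 2: "(\<Sum>i<n. x' i * Y i n) = b"
      unfolding b_def x'_def by (intro sum.cong) auto
    have 3: "x' n = - b / a" by (simp add: x'_def)
    have "0 \<le> bilinear_form (Suc n) Y x' x'" by (rule Suc.prems(2))
    also have "\<dots> = bilinear_form n Y x x - b * b / a"
      unfolding expand 1 2 a_def[symmetric] 3
      by (cases "a = 0") (simp_all add: field_simps power2_eq_square)
    also have "b * b / a = (\<Sum>i<n. \<Sum>j<n. x i * (Y i n * Y j n / a) * x j)"
      unfolding b_def sum_product sum_divide_distrib by (simp add: mult_ac)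
    also have "bilinear_form n Y x x - \<dots> = bilinear_form n Z x x"
      unfolding bilinear_form_def Z_def by (simp add: algebra_simps sum_subtractf)
    finally show "0 \<le> bilinear_form n Z x x" .
  qed
  then obtain v where v: "\<And>i j. i < n \<Longrightarrow> j < n \<Longrightarrow> Z i j = (\<Sum>k<n. v k i * v k j)"
    by blast
  define v' where "v' = (\<lambda>k i. if k = n then Y i n / sqrt a else if i = n then 0 else v k i)"
  have "Y i j = (\<Sum>k<Suc n. v' k i * v' k j)" if ij: "i < Suc n" "j < Suc n" for i j
  proof -
    have *: "Y i n / sqrt a * (Y j n / sqrt a) = Y i n * Y j n / a"
      using a0 by simp
    have "(\<Sum>k<n. v' k i * v' k j) = (if i = n \<or> j = n then 0 else Z i j)"
      using ij v[of i j] unfolding v'_def by auto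
    then have "(\<Sum>k<Suc n. v' k i * v' k j)
        = (if i = n \<or> j = n then 0 else Z i j) + Y i n * Y j n / a"
      using * by (simp add: v'_def)
    also have "\<dots> = Y i j"
      using ij zero_column[of i] zero_column[of j] sym[of j]
      by (cases "a = 0") (auto simp: Z_def a_def less_Suc_eq)
    finally show ?thesis by simp
  qed
  then show ?case by blast
qed

section \<open>The dual certificate\<close>

text \<open>
  The left-hand side is the form of the Laplacian with signed weights \<open>A i j * \<sigma> i * \<sigma> j\<close>, conjugated by
  \<open>\<sigma>\<close>: it equals half the sum of \<open>A i j * \<sigma> i * \<sigma> j * (\<sigma> i * x i - \<sigma> j * x j)\<^sup>2\<close>. Hence it does not change
  when a multiple of \<open>\<sigma>\<close> is added to \<open>x\<close>, and \<open>x\<close> may be replaced by its projection \<open>p\<close> orthogonal to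
  \<open>\<sigma>\<close>. On \<open>p\<close>, which is orthogonal to the all-ones vector as well, the signal part of \<open>A\<close> reduces to
  the correction \<open>- (m + h)\<close> of the zero diagonal, and this cancels against the same correction in
  the weighted degrees. What remains is \<open>n h\<close> minus the contributions of the noise.
\<close>

lemma laplacian_lower_bound:
  fixes \<sigma> :: "nat \<Rightarrow> real" and A W :: "nat \<Rightarrow> nat \<Rightarrow> real"
  assumes n: "0 < n"
    and \<sigma>: "\<And>i. i < n \<Longrightarrow> \<sigma> i * \<sigma> i = 1" "(\<Sum>i<n. \<sigma> i) = 0"
    and A: "\<And>i j. i < n \<Longrightarrow> j < n \<Longrightarrow>
        A i j = m + h * (\<sigma> i * \<sigma> j) + W i j - (if i = j then m + h else 0)"
    and W: "\<And>i j. W i j = W j i"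
    and row: "\<And>i. i < n \<Longrightarrow> - (\<Sum>j<n. W i j * (\<sigma> i * \<sigma> j)) \<le> a"
    and norm: "\<And>x. bilinear_form n W x x \<le> b * (\<Sum>i<n. (x i)\<^sup>2)"
    and x: "(\<Sum>i<n. x i) = 0"
  shows "(\<Sum>i<n. (\<Sum>j<n. A i j * (\<sigma> i * \<sigma> j)) * (x i)\<^sup>2) - bilinear_form n A x x
    \<ge> (real n * h - a - b) * ((\<Sum>i<n. (x i)\<^sup>2) - (\<Sum>i<n. \<sigma> i * x i)\<^sup>2 / real n)"
proof -
  define Q where "Q x = (\<Sum>i<n. (\<Sum>j<n. A i j * (\<sigma> i * \<sigma> j)) * (x i)\<^sup>2) - bilinear_form n A x x" for x
  have Asym: "A i j = A j i" if "i < n" "j < n" for i j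
    using that W[of i j] by (simp add: A mult.commute)
  have Q: "2 * Q x = (\<Sum>i<n. \<Sum>j<n. A i j * (\<sigma> i * \<sigma> j) * (\<sigma> i * x i - \<sigma> j * x j)\<^sup>2)" for x
  proof -
    have swap: "(\<Sum>i<n. \<Sum>j<n. A i j * (\<sigma> i * \<sigma> j) * (x j)\<^sup>2) = (\<Sum>i<n. \<Sum>j<n. A i j * (\<sigma> i * \<sigma> j) * (x i)\<^sup>2)"
      by (subst sum.swap) (intro sum.cong refl, auto simp: Asym mult_ac)
    have "A i j * (\<sigma> i * \<sigma> j) * (\<sigma> i * x i - \<sigma> j * x j)\<^sup>2
       = A i j * (\<sigma> i * \<sigma> j) * (x i)\<^sup>2 + A i j * (\<sigma> i * \<sigma> j) * (x j)\<^sup>2 - 2 * (x i * A i j * x j)"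
      if "i < n" "j < n" for i j
    proof -
      have "A i j * (\<sigma> i * \<sigma> j) * (\<sigma> i * x i - \<sigma> j * x j)\<^sup>2
        = A i j * (\<sigma> i * \<sigma> j) * ((\<sigma> i * \<sigma> i) * (x i)\<^sup>2 + (\<sigma> j * \<sigma> j) * (x j)\<^sup>2)
          - 2 * (A i j * ((\<sigma> i * \<sigma> i) * (\<sigma> j * \<sigma> j)) * x i * x j)"
        by (simp add: power2_eq_square algebra_simps)
      then show ?thesis using \<sigma>(1)[OF that(1)] \<sigma>(1)[OF that(2)] by (simp add: algebra_simps)
    qed
    then have "(\<Sum>i<n. \<Sum>j<n. A i j * (\<sigma> i * \<sigma> j) * (\<sigma> i * x i - \<sigma> j * x j)\<^sup>2)
      = (\<Sum>i<n. \<Sum>j<n. A i j * (\<sigma> i * \<sigma> j) * (x i)\<^sup>2 + A i j * (\<sigma> i * \<sigma> j) * (x j)\<^sup>2 - 2 * (x i * A i j * x j))"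
      by (intro sum.cong) auto
    then show ?thesis
      unfolding Q_def bilinear_form_def sum.distrib sum_subtractf swap
      by (simp add: sum_distrib_right sum_distrib_left)
  qed
  define t where "t = (\<Sum>i<n. \<sigma> i * x i) / real n"
  define p where "p = (\<lambda>i. x i - t * \<sigma> i)"
  have "\<sigma> i * p i - \<sigma> j * p j = \<sigma> i * x i - \<sigma> j * x j" if "i < n" "j < n" for i j
    using \<sigma>(1)[OF that(1)] \<sigma>(1)[OF that(2)] unfolding p_def
    by (simp add: right_diff_distrib mult.left_commute[of _ t])
  then have "2 * Q x = 2 * Q p" unfolding Q by (intro sum.cong) auto
  then have Qxp: "Q x = Q p" by simp
  have \<sigma>\<sigma>: "(\<Sum>i<n. \<sigma> i * \<sigma> i) = real n" using \<sigma>(1) by simp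
  have p1: "(\<Sum>i<n. p i) = 0"
    unfolding p_def sum_subtractf sum_distrib_left[symmetric] using x \<sigma>(2) by simp
  have p\<sigma>: "(\<Sum>i<n. \<sigma> i * p i) = 0"
  proof -
    have "(\<Sum>i<n. \<sigma> i * p i) = (\<Sum>i<n. \<sigma> i * x i) - t * (\<Sum>i<n. \<sigma> i * \<sigma> i)"
      unfolding p_def sum_distrib_left sum_subtractf[symmetric]
      by (intro sum.cong) (auto simp: algebra_simps)
    then show ?thesis using n unfolding \<sigma>\<sigma> t_def by simp
  qed
  have pp: "(\<Sum>i<n. (p i)\<^sup>2) = (\<Sum>i<n. (x i)\<^sup>2) - (\<Sum>i<n. \<sigma> i * x i)\<^sup>2 / real n"
  proof -
    have "(\<Sum>i<n. (p i)\<^sup>2) = (\<Sum>i<n. (x i)\<^sup>2) - 2 * t * (\<Sum>i<n. \<sigma> i * x i) + t\<^sup>2 * (\<Sum>i<n. \<sigma> i * \<sigma> i)"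
      unfolding p_def sum_distrib_left sum_subtractf[symmetric] sum.distrib[symmetric]
      by (intro sum.cong) (auto simp: algebra_simps power2_eq_square)
    then show ?thesis using n unfolding \<sigma>\<sigma> t_def by (simp add: field_simps power2_eq_square)
  qed
  have degree: "real n * h - (m + h) - a \<le> (\<Sum>j<n. A i j * (\<sigma> i * \<sigma> j))" if i: "i < n" for i
  proof -
    have "(\<Sum>j<n. A i j * (\<sigma> i * \<sigma> j))
      = (\<Sum>j<n. m * \<sigma> i * \<sigma> j + h * ((\<sigma> i * \<sigma> i) * (\<sigma> j * \<sigma> j)) + W i j * (\<sigma> i * \<sigma> j)
           - (if j = i then (m + h) * (\<sigma> i * \<sigma> i) else 0))"
      using i by (intro sum.cong) (auto simp: A algebra_simps)
    also have "\<dots> = (\<Sum>j<n. m * \<sigma> i * \<sigma> j + h + W i j * (\<sigma> i * \<sigma> j) - (if j = i then m + h else 0))"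
      using i by (intro sum.cong) (auto simp: \<sigma>(1))
    also have "\<dots> = m * \<sigma> i * (\<Sum>j<n. \<sigma> j) + real n * h + (\<Sum>j<n. W i j * (\<sigma> i * \<sigma> j)) - (m + h)"
      using i by (simp add: sum.distrib sum_subtractf sum_distrib_left)
    finally show ?thesis using row[OF i] \<sigma>(2) by simp
  qed
  have "(\<Sum>i<n. (real n * h - (m + h) - a) * (p i)\<^sup>2) \<le> (\<Sum>i<n. (\<Sum>j<n. A i j * (\<sigma> i * \<sigma> j)) * (p i)\<^sup>2)"
    by (intro sum_mono mult_right_mono degree) auto
  then have diag: "(real n * h - (m + h) - a) * (\<Sum>i<n. (p i)\<^sup>2) \<le> (\<Sum>i<n. (\<Sum>j<n. A i j * (\<sigma> i * \<sigma> j)) * (p i)\<^sup>2)"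
    by (simp add: sum_distrib_left)
  have "bilinear_form n A p p = (\<Sum>i<n. \<Sum>j<n. m * (p i * p j) + h * ((\<sigma> i * p i) * (\<sigma> j * p j)) + p i * W i j * p j
       - (if j = i then (m + h) * (p i)\<^sup>2 else 0))"
    unfolding bilinear_form_def
    by (intro sum.cong refl) (auto simp: A algebra_simps power2_eq_square)
  also have "\<dots> = m * ((\<Sum>i<n. p i) * (\<Sum>j<n. p j)) + h * ((\<Sum>i<n. \<sigma> i * p i) * (\<Sum>j<n. \<sigma> j * p j))
       + bilinear_form n W p p - (m + h) * (\<Sum>i<n. (p i)\<^sup>2)"
    unfolding bilinear_form_def sum_product by (simp add: sum.distrib sum_subtractf sum_distrib_left)
  also have "\<dots> = bilinear_form n W p p - (m + h) * (\<Sum>i<n. (p i)\<^sup>2)"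
    unfolding p1 p\<sigma> by simp
  also have "\<dots> \<le> b * (\<Sum>i<n. (p i)\<^sup>2) - (m + h) * (\<Sum>i<n. (p i)\<^sup>2)"
    using norm[of p] by simp
  finally have "(real n * h - a - b) * (\<Sum>i<n. (p i)\<^sup>2) \<le> Q p"
    using diag unfolding Q_def by (simp add: algebra_simps)
  then show ?thesis using Qxp unfolding pp Q_def by simp
qed

text \<open>
  Summing the previous bound over the Gram vectors of \<open>Y\<close> gives, with \<open>c = n h - a - b > 0\<close> and
  \<open>overlap = \<langle>\<sigma> \<sigma>\<^sup>T, Y\<rangle>\<close>, that \<open>c * (n - overlap / n)\<close> is at most the loss \<open>\<langle>A, \<sigma> \<sigma>\<^sup>T\<rangle> - \<langle>A, Y\<rangle>\<close>. If \<open>Y\<close> does not lose, its overlap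
  with \<open>\<sigma> \<sigma>\<^sup>T\<close> has the largest value \<open>n\<^sup>2\<close> that unit diagonal entries permit.
\<close>

lemma dual_certificate:
  fixes \<sigma> :: "nat \<Rightarrow> real" and A W Y :: "nat \<Rightarrow> nat \<Rightarrow> real"
  assumes n: "0 < n"
    and \<sigma>: "\<And>i. i < n \<Longrightarrow> \<sigma> i * \<sigma> i = 1" "(\<Sum>i<n. \<sigma> i) = 0"
    and A: "\<And>i j. i < n \<Longrightarrow> j < n \<Longrightarrow>
        A i j = m + h * (\<sigma> i * \<sigma> j) + W i j - (if i = j then m + h else 0)"
    and W: "\<And>i j. W i j = W j i"
    and row: "\<And>i. i < n \<Longrightarrow> - (\<Sum>j<n. W i j * (\<sigma> i * \<sigma> j)) \<le> a"
    and norm: "\<And>x. bilinear_form n W x x \<le> b * (\<Sum>i<n. (x i)\<^sup>2)"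
    and gap: "a + b < real n * h"
    and Y: "\<And>i j. i < n \<Longrightarrow> j < n \<Longrightarrow> Y i j = Y j i" "\<And>x. 0 \<le> bilinear_form n Y x x"
      "\<And>i. i < n \<Longrightarrow> Y i i = 1" "(\<Sum>i<n. \<Sum>j<n. Y i j) = 0"
    and max: "(\<Sum>i<n. \<Sum>j<n. A i j * (\<sigma> i * \<sigma> j)) \<le> (\<Sum>i<n. \<Sum>j<n. A i j * Y i j)"
    and ij: "i < n" "j < n"
  shows "Y i j = \<sigma> i * \<sigma> j"
proof -
  obtain v where v: "\<And>i j. i < n \<Longrightarrow> j < n \<Longrightarrow> Y i j = (\<Sum>k<n. v k i * v k j)"
    using psd_gram[of n Y] Y(1,2) by blast
  have expand: "(\<Sum>i<n. \<Sum>j<n. f i j * Y i j) = (\<Sum>k<n. bilinear_form n f (v k) (v k))" for f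
  proof -
    have "(\<Sum>i<n. \<Sum>j<n. f i j * Y i j) = (\<Sum>i<n. \<Sum>j<n. \<Sum>k<n. v k i * f i j * v k j)"
      using v by (intro sum.cong) (auto simp: sum_distrib_left mult_ac)
    also have "\<dots> = (\<Sum>i<n. \<Sum>k<n. \<Sum>j<n. v k i * f i j * v k j)"
      by (intro sum.cong refl sum.swap)
    also have "\<dots> = (\<Sum>k<n. \<Sum>i<n. \<Sum>j<n. v k i * f i j * v k j)" by (rule sum.swap)
    finally show ?thesis unfolding bilinear_form_def .
  qed
  \<comment> \<open>\<open>\<langle>J, Y\<rangle> = 0\<close> is a vanishing sum of squares.\<close>
  have "(\<Sum>k<n. (\<Sum>i<n. v k i)\<^sup>2) = 0"
    using expand[of "\<lambda>_ _. 1"] Y(4)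
    by (simp add: bilinear_form_def power2_eq_square sum_product)
  then have orth: "(\<Sum>i<n. v k i) = 0" if "k < n" for k
    using that by (subst (asm) sum_nonneg_eq_0_iff) auto
  have vv: "(\<Sum>k<n. (v k i)\<^sup>2) = 1" if "i < n" for i
    using v[OF that that] Y(3)[OF that] by (simp add: power2_eq_square)
  define d where "d i = (\<Sum>j<n. A i j * (\<sigma> i * \<sigma> j))" for i
  define c where "c = real n * h - a - b"
  define overlap where "overlap = (\<Sum>i<n. \<Sum>j<n. \<sigma> i * \<sigma> j * Y i j)"
  have "(\<Sum>k<n. c * ((\<Sum>i<n. (v k i)\<^sup>2) - (\<Sum>i<n. \<sigma> i * v k i)\<^sup>2 / real n))
     \<le> (\<Sum>k<n. (\<Sum>i<n. d i * (v k i)\<^sup>2) - bilinear_form n A (v k) (v k))"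
    unfolding c_def d_def using orth
    by (intro sum_mono laplacian_lower_bound[OF n \<sigma> A W row norm]) auto
  also have "\<dots> = (\<Sum>k<n. (\<Sum>i<n. d i * (v k i)\<^sup>2)) - (\<Sum>i<n. \<Sum>j<n. A i j * Y i j)"
    unfolding expand sum_subtractf ..
  also have "(\<Sum>k<n. (\<Sum>i<n. d i * (v k i)\<^sup>2)) = (\<Sum>i<n. d i)"
    by (subst sum.swap) (simp add: sum_distrib_left[symmetric] vv)
  also have "(\<Sum>i<n. d i) - (\<Sum>i<n. \<Sum>j<n. A i j * Y i j) \<le> 0"
    using max unfolding d_def by simp
  finally have "c * ((\<Sum>k<n. \<Sum>i<n. (v k i)\<^sup>2) - (\<Sum>k<n. (\<Sum>i<n. \<sigma> i * v k i)\<^sup>2) / real n) \<le> 0"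
    by (simp add: sum_distrib_left[symmetric] sum_subtractf sum_divide_distrib[symmetric])
  moreover have "(\<Sum>k<n. \<Sum>i<n. (v k i)\<^sup>2) = real n"
    by (subst sum.swap) (simp add: vv)
  moreover have "(\<Sum>k<n. (\<Sum>i<n. \<sigma> i * v k i)\<^sup>2) = overlap"
    unfolding overlap_def expand
    by (simp add: bilinear_form_def power2_eq_square sum_product mult_ac)
  ultimately have "c * (real n - overlap / real n) \<le> 0" by simp
  moreover have "0 < c" using gap unfolding c_def by simp
  ultimately have "real n \<le> overlap / real n" by (simp add: mult_le_0_iff)
  then have le: "real n * real n \<le> overlap" using n by (simp add: field_simps)
  \<comment> \<open>No \<open>\<sigma> i * \<sigma> j * Y i j\<close> exceeds 1, so \<open>le\<close> makes all of them equal to 1.\<close>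
  have gapsq: "1 - \<sigma> i * \<sigma> j * Y i j = (\<Sum>k<n. (\<sigma> i * v k i - \<sigma> j * v k j)\<^sup>2) / 2"
    if "i < n" "j < n" for i j
  proof -
    have "(\<Sum>k<n. (\<sigma> i * v k i - \<sigma> j * v k j)\<^sup>2)
       = (\<sigma> i * \<sigma> i) * (\<Sum>k<n. (v k i)\<^sup>2) + (\<sigma> j * \<sigma> j) * (\<Sum>k<n. (v k j)\<^sup>2) - 2 * (\<sigma> i * \<sigma> j) * (\<Sum>k<n. v k i * v k j)"
      unfolding sum_distrib_left sum_subtractf[symmetric] sum.distrib[symmetric]
      by (intro sum.cong refl) (simp add: power2_eq_square algebra_simps)
    then show ?thesis using that by (simp add: vv \<sigma>(1) v)
  qed
  have nonneg: "0 \<le> 1 - \<sigma> i * \<sigma> j * Y i j" if "i < n" "j < n" for i j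
    unfolding gapsq[OF that] by (simp add: sum_nonneg)
  have "(\<Sum>i<n. \<Sum>j<n. 1 - \<sigma> i * \<sigma> j * Y i j) = real n * real n - overlap"
    unfolding overlap_def sum_subtractf by simp
  moreover have "0 \<le> (\<Sum>i<n. \<Sum>j<n. 1 - \<sigma> i * \<sigma> j * Y i j)"
    by (intro sum_nonneg nonneg) auto
  ultimately have "(\<Sum>i<n. \<Sum>j<n. 1 - \<sigma> i * \<sigma> j * Y i j) = 0" using le by simp
  then have "(\<Sum>j<n. 1 - \<sigma> i * \<sigma> j * Y i j) = 0"
    using ij nonneg by (subst (asm) sum_nonneg_eq_0_iff) (auto intro!: sum_nonneg)
  then have one: "\<sigma> i * \<sigma> j * Y i j = 1"
    using ij nonneg by (subst (asm) sum_nonneg_eq_0_iff) auto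
  have "Y i j = (\<sigma> i * \<sigma> i) * (\<sigma> j * \<sigma> j) * Y i j" using \<sigma>(1) ij by simp
  also have "\<dots> = \<sigma> i * \<sigma> j * (\<sigma> i * \<sigma> j * Y i j)" by (simp add: mult_ac)
  also have "\<dots> = \<sigma> i * \<sigma> j" unfolding one by simp
  finally show ?thesis .
qed

section \<open>A lattice net for the unit ball\<close>

text \<open>
  Scaled by \<open>1 / (4 * sqrt n)\<close>, these lattice points form a \<open>1/4\<close>-net of the unit ball of \<open>\<real>\<^sup>n\<close> that
  consists of points of the ball. The bound on the sum of absolute values follows from the Euclidean
  one by the Cauchy-Schwarz inequality; it is the one that allows the points to be counted.
\<close>

definition ball_net :: "nat \<Rightarrow> (nat \<Rightarrow> int) set" where
  "ball_net n = {z \<in> {..<n} \<rightarrow>\<^sub>E UNIV.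
     (\<Sum>i<n. \<bar>z i\<bar>) \<le> 4 * int n \<and> (\<Sum>i<n. (real_of_int (z i))\<^sup>2) \<le> 16 * real n}"

lemma net_subset_box: "ball_net n \<subseteq> {..<n} \<rightarrow>\<^sub>E {- (4 * int n)..4 * int n}"
proof
  fix z assume z: "z \<in> ball_net n"
  have "\<bar>z i\<bar> \<le> 4 * int n" if "i < n" for i
  proof -
    have "\<bar>z i\<bar> \<le> (\<Sum>i<n. \<bar>z i\<bar>)" using that by (intro member_le_sum) auto
    with z show ?thesis by (auto simp: ball_net_def)
  qed
  then show "z \<in> {..<n} \<rightarrow>\<^sub>E {- (4 * int n)..4 * int n}"
    using z by (auto simp: ball_net_def PiE_iff abs_le_iff minus_le_iff)
qed

lemma finite_net: "finite (ball_net n)"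
  by (rule finite_subset[OF net_subset_box]) (auto intro!: finite_PiE)

lemma sum_half_powers: "(\<Sum>k\<in>{- int m..int m}. (1/2::real) ^ nat \<bar>k\<bar>) = 3 - 2 * (1/2) ^ m"
proof (induction m)
  case 0
  then show ?case by simp
next
  case (Suc m)
  have "{- int (Suc m)..int (Suc m)} = insert (int (Suc m)) (insert (- int (Suc m)) {- int m..int m})"
    by auto
  moreover have "- int (Suc m) \<notin> {- int m..int m}" "int (Suc m) \<notin> insert (- int (Suc m)) {- int m..int m}"
    by auto
  ultimately have "(\<Sum>k\<in>{- int (Suc m)..int (Suc m)}. (1/2::real) ^ nat \<bar>k\<bar>)
     = (1/2) ^ Suc m + ((1/2) ^ Suc m + (\<Sum>k\<in>{- int m..int m}. (1/2::real) ^ nat \<bar>k\<bar>))"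
    by (simp add: nat_add_distrib)
  then show ?case unfolding Suc by simp
qed

text \<open>
  Give every integer vector the weight \<open>\<Prod>i. (1/2) ^ \<bar>z i\<bar>\<close>. The total weight factorizes over the
  coordinates and is at most \<open>3 ^ n\<close>, while each net point weighs at least \<open>(1/2) ^ (4 * n)\<close>, so there
  are at most \<open>(3 * 2 ^ 4) ^ n\<close> of them.
\<close>

lemma card_net: "real (card (ball_net n)) \<le> 48 ^ n"
proof -
  let ?B = "{- (4 * int n)..4 * int n}"
  have B: "(\<Sum>k\<in>?B. (1/2::real) ^ nat \<bar>k\<bar>) \<le> 3"
  proof -
    have "(\<Sum>k\<in>?B. (1/2::real) ^ nat \<bar>k\<bar>) = 3 - 2 * (1/2) ^ (4 * n)"
      using sum_half_powers[of "4 * n"] by (simp only: of_nat_mult of_nat_numeral)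
    moreover have "0 \<le> (1/2::real) ^ (4 * n)" by (rule zero_le_power) simp
    ultimately show ?thesis by linarith
  qed
  have "real (card (ball_net n)) * (1/2) ^ (4 * n) = (\<Sum>z\<in>ball_net n. (1/2::real) ^ (4 * n))" by simp
  also have "\<dots> \<le> (\<Sum>z\<in>ball_net n. \<Prod>i<n. (1/2::real) ^ nat \<bar>z i\<bar>)"
  proof (rule sum_mono)
    fix z assume "z \<in> ball_net n"
    then have "(\<Sum>i<n. \<bar>z i\<bar>) \<le> int (4 * n)" by (simp add: ball_net_def)
    moreover have "(\<Sum>i<n. \<bar>z i\<bar>) = int (\<Sum>i<n. nat \<bar>z i\<bar>)" by simp
    ultimately have "(\<Sum>i<n. nat \<bar>z i\<bar>) \<le> 4 * n" by linarith
    then have "(1/2::real) ^ (4 * n) \<le> (1/2) ^ (\<Sum>i<n. nat \<bar>z i\<bar>)"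
      by (intro power_decreasing) auto
    then show "(1/2::real) ^ (4 * n) \<le> (\<Prod>i<n. (1/2) ^ nat \<bar>z i\<bar>)"
      by (simp only: power_sum)
  qed
  also have "\<dots> \<le> (\<Sum>z\<in>{..<n} \<rightarrow>\<^sub>E ?B. \<Prod>i<n. (1/2::real) ^ nat \<bar>z i\<bar>)"
  proof (rule sum_mono2[OF _ net_subset_box])
    show "finite ({..<n} \<rightarrow>\<^sub>E ?B)" by (simp add: finite_PiE)
    show "0 \<le> (\<Prod>i<n. (1/2::real) ^ nat \<bar>z i\<bar>)" for z :: "nat \<Rightarrow> int"
      by (intro prod_nonneg) simp
  qed
  also have "\<dots> = (\<Prod>i<n. \<Sum>k\<in>?B. (1/2::real) ^ nat \<bar>k\<bar>)"
    by (rule prod_sum_PiE[symmetric]) simp_all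
  also have "\<dots> = (\<Sum>k\<in>?B. (1/2::real) ^ nat \<bar>k\<bar>) ^ n" by simp
  also have "\<dots> \<le> 3 ^ n"
    by (intro power_mono B sum_nonneg) auto
  finally have "real (card (ball_net n)) \<le> 3 ^ n * 2 ^ (4 * n)"
    by (simp only: power_one_over) (simp add: divide_le_eq)
  also have "\<dots> = (3 * 2 ^ 4) ^ n"
    unfolding power_mult_distrib power_mult ..
  also have "\<dots> = 48 ^ n" by simp
  finally show ?thesis .
qed

text \<open>
  Round each coordinate of \<open>4 * sqrt n * x\<close> towards zero: this does not increase its absolute value, so
  the result stays in the scaled ball, and it moves each of the \<open>n\<close> coordinates of \<open>x\<close> by at most
  \<open>1 / (4 * sqrt n)\<close>.
\<close>

lemma ex_net_approx:
  assumes n: "0 < n" and x: "(\<Sum>i<n. (x i)\<^sup>2) \<le> 1"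
  shows "\<exists>z\<in>ball_net n. (\<Sum>i<n. (x i - real_of_int (z i) / (4 * sqrt (real n)))\<^sup>2) \<le> 1 / 16"
proof -
  define s where "s = 4 * sqrt (real n)"
  have s: "0 < s" "s\<^sup>2 = 16 * real n" using n by (auto simp: s_def power_mult_distrib)
  define z where "z = (\<lambda>i\<in>{..<n}. if 0 \<le> x i then \<lfloor>s * x i\<rfloor> else \<lceil>s * x i\<rceil>)"
  have zx: "\<bar>real_of_int (z i)\<bar> \<le> s * \<bar>x i\<bar>" "\<bar>s * x i - real_of_int (z i)\<bar> \<le> 1" if "i < n" for i
  proof -
    show "\<bar>s * x i - real_of_int (z i)\<bar> \<le> 1"
      using that unfolding z_def by simp linarith
    show "\<bar>real_of_int (z i)\<bar> \<le> s * \<bar>x i\<bar>"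
    proof (cases "0 \<le> x i")
      case True
      then have "0 \<le> s * x i" using s by simp
      then show ?thesis using True that by (simp add: z_def)
    next
      case False
      then have "s * x i \<le> 0" using s by (simp add: mult_nonneg_nonpos)
      then have "\<lceil>s * x i\<rceil> \<le> 0" by (simp add: ceiling_le_zero)
      moreover have "s * x i \<le> real_of_int \<lceil>s * x i\<rceil>" by (rule le_of_int_ceiling)
      ultimately show ?thesis using False that by (simp add: z_def)
    qed
  qed
  have sq: "(\<Sum>i<n. (real_of_int (z i))\<^sup>2) \<le> 16 * real n"
  proof -
    have "(\<Sum>i<n. (real_of_int (z i))\<^sup>2) \<le> (\<Sum>i<n. s\<^sup>2 * (x i)\<^sup>2)"
    proof (rule sum_mono)
      fix i assume "i \<in> {..<n}"
      then have "\<bar>real_of_int (z i)\<bar>\<^sup>2 \<le> (s * \<bar>x i\<bar>)\<^sup>2"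
        using zx(1)[of i] by (intro power_mono) auto
      then show "(real_of_int (z i))\<^sup>2 \<le> s\<^sup>2 * (x i)\<^sup>2" by (simp add: power_mult_distrib)
    qed
    also have "\<dots> \<le> s\<^sup>2 * 1"
      unfolding sum_distrib_left[symmetric] using x by (intro mult_left_mono) auto
    finally show ?thesis using s by simp
  qed
  have "(\<Sum>i<n. \<bar>real_of_int (z i)\<bar> * 1)\<^sup>2
      \<le> (\<Sum>i<n. \<bar>real_of_int (z i)\<bar>\<^sup>2) * (\<Sum>i<n. 1\<^sup>2)"
    by (rule Cauchy_Schwarz_ineq_sum)
  also have "\<dots> \<le> 16 * real n * real n"
    using sq by (simp add: mult_right_mono)
  also have "\<dots> = (4 * real n)\<^sup>2" by (simp add: power2_eq_square)
  finally have "(\<Sum>i<n. \<bar>real_of_int (z i)\<bar> * 1) \<le> 4 * real n"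
    by (rule power2_le_imp_le) simp
  then have "real_of_int (\<Sum>i<n. \<bar>z i\<bar>) \<le> real_of_int (4 * int n)" by simp
  then have "(\<Sum>i<n. \<bar>z i\<bar>) \<le> 4 * int n" by (simp only: of_int_le_iff)
  then have "z \<in> ball_net n" using sq unfolding ball_net_def z_def by auto
  moreover have "(\<Sum>i<n. (x i - real_of_int (z i) / s)\<^sup>2) \<le> (\<Sum>i<n. 1 / s\<^sup>2)"
  proof (rule sum_mono)
    fix i assume "i \<in> {..<n}"
    then have "\<bar>s * x i - real_of_int (z i)\<bar>\<^sup>2 \<le> 1\<^sup>2"
      using zx(2)[of i] by (intro power_mono) auto
    then have "(s * x i - real_of_int (z i))\<^sup>2 / s\<^sup>2 \<le> 1 / s\<^sup>2"
      using s by (intro divide_right_mono) auto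
    moreover have "x i - real_of_int (z i) / s = (s * x i - real_of_int (z i)) / s"
      using s by (simp add: field_simps)
    ultimately show "(x i - real_of_int (z i) / s)\<^sup>2 \<le> 1 / s\<^sup>2" by (simp add: power_divide)
  qed
  moreover have "(\<Sum>i<n. 1 / s\<^sup>2) = 1 / 16" using n by (simp add: s(2))
  ultimately show ?thesis unfolding s_def[symmetric] by (intro bexI[of _ z]) linarith+
qed

text \<open>
  Let \<open>K\<close> be the supremum of the form over pairs of vectors in the unit ball. Replacing both arguments
  by net points costs at most \<open>K / 4\<close> each, so \<open>K\<close> is at most the maximum over the scaled net plus
  \<open>K / 2\<close>; as \<open>K\<close> is finite, it can be absorbed. The scaling \<open>1 / (4 * sqrt n)\<close> of both arguments
  turns \<open>T\<close> into \<open>T / (16 * n)\<close>.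
\<close>

lemma bilinear_form_le_of_net:
  assumes n: "0 < n"
    and T: "\<And>z w. z \<in> ball_net n \<Longrightarrow> w \<in> ball_net n \<Longrightarrow>
      bilinear_form n W (\<lambda>i. real_of_int (z i)) (\<lambda>i. real_of_int (w i)) \<le> T"
  shows "bilinear_form n W x x \<le> T / (8 * real n) * (\<Sum>i<n. (x i)\<^sup>2)"
proof -
  define ball where "ball = {x :: nat \<Rightarrow> real. (\<Sum>i<n. (x i)\<^sup>2) \<le> 1}"
  define K where "K = (SUP p \<in> ball \<times> ball. bilinear_form n W (fst p) (snd p))"
  have coord: "\<bar>x i\<bar> \<le> 1" if "x \<in> ball" "i < n" for x i
  proof -
    have "(x i)\<^sup>2 \<le> (\<Sum>i<n. (x i)\<^sup>2)" using that by (intro member_le_sum) auto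
    then have "(x i)\<^sup>2 \<le> 1" using that by (simp add: ball_def)
    then show ?thesis by (simp add: abs_square_le_1)
  qed
  have bdd: "bdd_above ((\<lambda>p. bilinear_form n W (fst p) (snd p)) ` (ball \<times> ball))"
  proof (rule bdd_aboveI2)
    fix p assume "p \<in> ball \<times> ball"
    then have p: "fst p \<in> ball" "snd p \<in> ball" by auto
    show "bilinear_form n W (fst p) (snd p) \<le> (\<Sum>i<n. \<Sum>j<n. \<bar>W i j\<bar>)"
      unfolding bilinear_form_def
    proof (intro sum_mono)
      fix i j assume "i \<in> {..<n}" "j \<in> {..<n}"
      then have "\<bar>fst p i\<bar> * \<bar>snd p j\<bar> * \<bar>W i j\<bar> \<le> 1 * 1 * \<bar>W i j\<bar>"
        using coord p by (intro mult_mono) auto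
      moreover have "fst p i * W i j * snd p j \<le> \<bar>fst p i\<bar> * \<bar>snd p j\<bar> * \<bar>W i j\<bar>"
        using abs_ge_self[of "fst p i * W i j * snd p j"] by (simp add: abs_mult mult_ac)
      ultimately show "fst p i * W i j * snd p j \<le> \<bar>W i j\<bar>" by simp
    qed
  qed
  have K: "bilinear_form n W x y \<le> K" if "x \<in> ball" "y \<in> ball" for x y
    unfolding K_def using cSUP_upper[OF _ bdd, of "(x, y)"] that by simp
  define r where "r = 1 / (4 * sqrt (real n))"
  have r: "r * r = 1 / (16 * real n)" using n by (simp add: r_def)
  have "bilinear_form n W x y \<le> T / (16 * real n) + K / 2" if xy: "x \<in> ball" "y \<in> ball" for x y
  proof -
    obtain z where z: "z \<in> ball_net n" "(\<Sum>i<n. (x i - r * real_of_int (z i))\<^sup>2) \<le> 1 / 16"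
      using ex_net_approx[OF n, of x] xy by (auto simp: ball_def r_def)
    obtain w where w: "w \<in> ball_net n" "(\<Sum>i<n. (y i - r * real_of_int (w i))\<^sup>2) \<le> 1 / 16"
      using ex_net_approx[OF n, of y] xy by (auto simp: ball_def r_def)
    have small: "(\<lambda>i. 4 * f i) \<in> ball" if "(\<Sum>i<n. (f i)\<^sup>2) \<le> 1 / 16" for f
      using that by (simp add: ball_def power_mult_distrib sum_distrib_left[symmetric])
    have "(\<Sum>i<n. (r * real_of_int (z i))\<^sup>2) = (r * r) * (\<Sum>i<n. (real_of_int (z i))\<^sup>2)"
      by (simp add: sum_distrib_left power2_eq_square mult_ac)
    also have "\<dots> \<le> (r * r) * (16 * real n)"
      using z(1) by (intro mult_left_mono) (auto simp: ball_net_def r)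
    finally have zball: "(\<lambda>i. r * real_of_int (z i)) \<in> ball" using n by (simp add: r ball_def)
    have "bilinear_form n W x y
      = bilinear_form n W (\<lambda>i. r * real_of_int (z i) + (x i - r * real_of_int (z i))) y" by simp
    also have "\<dots> = bilinear_form n W (\<lambda>i. r * real_of_int (z i)) y
        + bilinear_form n W (\<lambda>i. x i - r * real_of_int (z i)) y"
      by (rule bilinear_form_add_left)
    also have "bilinear_form n W (\<lambda>i. x i - r * real_of_int (z i)) y \<le> K / 4"
      using K[OF small[OF z(2)] xy(2)]
        bilinear_form_scale[of n W 4 "\<lambda>i. x i - r * real_of_int (z i)" 1 y] by simp
    also have "bilinear_form n W (\<lambda>i. r * real_of_int (z i)) y
      = bilinear_form n W (\<lambda>i. r * real_of_int (z i)) (\<lambda>i. r * real_of_int (w i) + (y i - r * real_of_int (w i)))"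
      by simp
    also have "\<dots> = bilinear_form n W (\<lambda>i. r * real_of_int (z i)) (\<lambda>i. r * real_of_int (w i))
        + bilinear_form n W (\<lambda>i. r * real_of_int (z i)) (\<lambda>i. y i - r * real_of_int (w i))"
      by (rule bilinear_form_add_right)
    also have "bilinear_form n W (\<lambda>i. r * real_of_int (z i)) (\<lambda>i. y i - r * real_of_int (w i)) \<le> K / 4"
      using K[OF zball small[OF w(2)]]
        bilinear_form_scale[of n W 1 "\<lambda>i. r * real_of_int (z i)" 4 "\<lambda>i. y i - r * real_of_int (w i)"]
      by simp
    also have "bilinear_form n W (\<lambda>i. r * real_of_int (z i)) (\<lambda>i. r * real_of_int (w i)) \<le> T / (16 * real n)"
      unfolding bilinear_form_scale r using T[OF z(1) w(1)] n by (simp add: field_simps)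
    finally show ?thesis by simp
  qed
  moreover have "(\<lambda>_. 0) \<in> ball" by (simp add: ball_def)
  ultimately have "K \<le> T / (16 * real n) + K / 2"
    unfolding K_def by (intro cSUP_least) auto
  then have KT: "K \<le> T / (8 * real n)" by (simp add: field_simps)
  define q where "q = sqrt (\<Sum>i<n. (x i)\<^sup>2)"
  have q2: "q * q = (\<Sum>i<n. (x i)\<^sup>2)" unfolding q_def by (simp add: sum_nonneg)
  have "bilinear_form n W x x \<le> K * (q * q)"
  proof (cases "q = 0")
    case True
    then have "(\<Sum>i<n. (x i)\<^sup>2) = 0" using q2 by simp
    then have "\<And>i. i < n \<Longrightarrow> x i = 0" by (subst (asm) sum_nonneg_eq_0_iff) auto
    then show ?thesis using True by (simp add: bilinear_form_def)
  next
    case False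
    have "(\<Sum>i<n. (1 / q * x i)\<^sup>2) = (1 / q)\<^sup>2 * (\<Sum>i<n. (x i)\<^sup>2)"
      unfolding power_mult_distrib sum_distrib_left ..
    then have "(\<Sum>i<n. (1 / q * x i)\<^sup>2) = (q * q) / (q * q)"
      unfolding q2[symmetric] by (simp add: power2_eq_square)
    then have "(\<lambda>i. 1 / q * x i) \<in> ball" using False by (simp add: ball_def)
    then have "1 / q * (1 / q) * bilinear_form n W x x \<le> K"
      using K unfolding bilinear_form_scale[symmetric] by blast
    moreover have "0 < q * q" using False by (simp add: zero_less_mult_iff) linarith
    ultimately show ?thesis by (simp add: divide_le_eq)
  qed
  also have "\<dots> \<le> T / (8 * real n) * (q * q)" by (intro mult_right_mono KT) auto
  finally show ?thesis unfolding q2 .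
qed

section \<open>Tail bounds for Gaussian linear forms\<close>

text \<open>
  The exponential tilt of a Gaussian density is, up to the constant on the right, the density of a
  Gaussian with shifted mean.
\<close>

lemma nn_integral_exp_normal:
  assumes \<tau>: "0 < \<tau>"
  shows "(\<integral>\<^sup>+x. ennreal (exp (\<theta> * (x - \<mu>))) \<partial>density lborel (\<lambda>x. ennreal (normal_density \<mu> \<tau> x)))
    = ennreal (exp (\<theta>\<^sup>2 * \<tau>\<^sup>2 / 2))"
proof -
  have shift: "normal_density \<mu> \<tau> x * exp (\<theta> * (x - \<mu>))
      = exp (\<theta>\<^sup>2 * \<tau>\<^sup>2 / 2) * normal_density (\<mu> + \<theta> * \<tau>\<^sup>2) \<tau> x" for x
  proof -
    have "- (x - \<mu>)\<^sup>2 / (2 * \<tau>\<^sup>2) + \<theta> * (x - \<mu>)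
        = \<theta>\<^sup>2 * \<tau>\<^sup>2 / 2 - (x - (\<mu> + \<theta> * \<tau>\<^sup>2))\<^sup>2 / (2 * \<tau>\<^sup>2)"
      using \<tau> by (simp add: divide_simps) (simp add: algebra_simps power2_eq_square power4_eq_xxxx)
    then have "exp (- (x - \<mu>)\<^sup>2 / (2 * \<tau>\<^sup>2)) * exp (\<theta> * (x - \<mu>))
        = exp (\<theta>\<^sup>2 * \<tau>\<^sup>2 / 2) * exp (- (x - (\<mu> + \<theta> * \<tau>\<^sup>2))\<^sup>2 / (2 * \<tau>\<^sup>2))"
      by (simp add: exp_add[symmetric])
    then show ?thesis unfolding normal_density_def by (simp add: mult_ac)
  qed
  have "(\<integral>\<^sup>+x. ennreal (exp (\<theta> * (x - \<mu>))) \<partial>density lborel (\<lambda>x. ennreal (normal_density \<mu> \<tau> x)))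
      = (\<integral>\<^sup>+x. ennreal (normal_density \<mu> \<tau> x) * ennreal (exp (\<theta> * (x - \<mu>))) \<partial>lborel)"
    by (rule nn_integral_density) auto
  also have "\<dots> = (\<integral>\<^sup>+x. ennreal (exp (\<theta>\<^sup>2 * \<tau>\<^sup>2 / 2)) * ennreal (normal_density (\<mu> + \<theta> * \<tau>\<^sup>2) \<tau> x) \<partial>lborel)"
    by (intro nn_integral_cong) (metis shift ennreal_mult normal_density_nonneg exp_ge_zero)
  also have "\<dots> = ennreal (exp (\<theta>\<^sup>2 * \<tau>\<^sup>2 / 2)) * (\<integral>\<^sup>+x. ennreal (normal_density (\<mu> + \<theta> * \<tau>\<^sup>2) \<tau> x) \<partial>lborel)"
    by (rule nn_integral_cmult) auto
  also have "(\<integral>\<^sup>+x. ennreal (normal_density (\<mu> + \<theta> * \<tau>\<^sup>2) \<tau> x) \<partial>lborel) = 1"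
    using \<tau> by (subst nn_integral_eq_integral) auto
  finally show ?thesis by simp
qed

text \<open>
  Chernoff's bound: by independence the moment generating function of the linear form at \<open>\<theta>\<close> is at
  most \<open>exp (\<theta>\<^sup>2 * \<tau>\<^sup>2 * V / 2)\<close>, and Markov's inequality for \<open>exp (\<theta> * L)\<close> is optimal at
  \<open>\<theta> = t / (V * \<tau>\<^sup>2)\<close>.
\<close>

lemma gaussian_linear_tail:
  fixes c \<mu> :: "'i \<Rightarrow> real" and E :: "'i set" and \<tau> V t :: real
  defines "M \<equiv> (\<Pi>\<^sub>M e\<in>E. density lborel (\<lambda>x. ennreal (normal_density (\<mu> e) \<tau> x)))"
  assumes E: "finite E" and \<tau>: "0 < \<tau>" and V: "0 < V" "(\<Sum>e\<in>E. (c e)\<^sup>2) \<le> V"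
    and t: "0 \<le> t"
  shows "{\<omega> \<in> space M. t \<le> (\<Sum>e\<in>E. c e * (\<omega> e - \<mu> e))} \<in> sets M"
    and "measure M {\<omega> \<in> space M. t \<le> (\<Sum>e\<in>E. c e * (\<omega> e - \<mu> e))}
      \<le> exp (- t\<^sup>2 / (2 * V * \<tau>\<^sup>2))"
proof -
  let ?N = "\<lambda>e. density lborel (\<lambda>x. ennreal (normal_density (\<mu> e) \<tau> x))"
  interpret product_prob_space ?N E
    by (rule product_prob_spaceI) (rule prob_space_normal_density[OF \<tau>])
  have comp: "(\<lambda>\<omega>. \<omega> e) \<in> borel_measurable M" if "e \<in> E" for e
  proof -
    have "(\<lambda>\<omega>. \<omega> e) \<in> measurable M (?N e)"
      unfolding M_def by (rule measurable_component_singleton[OF that])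
    also have "measurable M (?N e) = borel_measurable M"
      by (rule measurable_cong_sets) simp_all
    finally show ?thesis .
  qed
  define L where "L \<omega> = (\<Sum>e\<in>E. c e * (\<omega> e - \<mu> e))" for \<omega>
  have L: "L \<in> borel_measurable M"
    unfolding L_def by (intro borel_measurable_sum borel_measurable_times borel_measurable_diff comp) auto
  then show meas: "{\<omega> \<in> space M. t \<le> (\<Sum>e\<in>E. c e * (\<omega> e - \<mu> e))} \<in> sets M"
    unfolding L_def[symmetric] by measurable
  define \<theta> where "\<theta> = t / (V * \<tau>\<^sup>2)"
  have "(\<integral>\<^sup>+\<omega>. ennreal (exp (\<theta> * L \<omega>)) \<partial>M)
     = (\<integral>\<^sup>+\<omega>. (\<Prod>e\<in>E. ennreal (exp (\<theta> * c e * (\<omega> e - \<mu> e)))) \<partial>M)"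
    unfolding L_def using E
    by (simp add: sum_distrib_left exp_sum prod_ennreal mult.assoc)
  also have "\<dots> = (\<Prod>e\<in>E. \<integral>\<^sup>+x. ennreal (exp (\<theta> * c e * (x - \<mu> e))) \<partial>?N e)"
    unfolding M_def by (rule product_nn_integral_prod[OF E]) auto
  also have "\<dots> = (\<Prod>e\<in>E. ennreal (exp ((\<theta> * c e)\<^sup>2 * \<tau>\<^sup>2 / 2)))"
    by (simp only: nn_integral_exp_normal[OF \<tau>])
  also have "\<dots> = ennreal (exp (\<Sum>e\<in>E. (\<theta> * c e)\<^sup>2 * \<tau>\<^sup>2 / 2))"
    using E by (simp add: exp_sum prod_ennreal)
  also have "(\<Sum>e\<in>E. (\<theta> * c e)\<^sup>2 * \<tau>\<^sup>2 / 2) = \<theta>\<^sup>2 * \<tau>\<^sup>2 / 2 * (\<Sum>e\<in>E. (c e)\<^sup>2)"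
    unfolding sum_distrib_left by (intro sum.cong) (auto simp: power_mult_distrib)
  also have "ennreal (exp \<dots>) \<le> ennreal (exp (\<theta>\<^sup>2 * \<tau>\<^sup>2 / 2 * V))"
    using V(2) by (intro ennreal_leI) (simp add: mult_left_mono)
  finally have mgf: "(\<integral>\<^sup>+\<omega>. ennreal (exp (\<theta> * L \<omega>)) \<partial>M) \<le> ennreal (exp (\<theta>\<^sup>2 * \<tau>\<^sup>2 / 2 * V))" .
  show "measure M {\<omega> \<in> space M. t \<le> (\<Sum>e\<in>E. c e * (\<omega> e - \<mu> e))} \<le> exp (- t\<^sup>2 / (2 * V * \<tau>\<^sup>2))"
  proof -
    have \<theta>: "0 \<le> \<theta>" using V t by (simp add: \<theta>_def)
    have "emeasure M {\<omega> \<in> space M. t \<le> L \<omega>}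
       \<le> emeasure M {\<omega> \<in> space M. 1 \<le> ennreal (exp (- \<theta> * t)) * ennreal (exp (\<theta> * L \<omega>))}"
    proof (rule emeasure_mono)
      show "{\<omega> \<in> space M. 1 \<le> ennreal (exp (- \<theta> * t)) * ennreal (exp (\<theta> * L \<omega>))} \<in> sets M"
        using L by measurable
      show "{\<omega> \<in> space M. t \<le> L \<omega>}
        \<subseteq> {\<omega> \<in> space M. 1 \<le> ennreal (exp (- \<theta> * t)) * ennreal (exp (\<theta> * L \<omega>))}"
        using \<theta> by (auto simp: ennreal_mult'[symmetric] exp_add[symmetric] mult_left_mono)
    qed
    also have "\<dots> \<le> ennreal (exp (- \<theta> * t)) * (\<integral>\<^sup>+\<omega>. ennreal (exp (\<theta> * L \<omega>)) * indicator (space M) \<omega> \<partial>M)"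
      by (rule nn_integral_Markov_inequality) (use L in measurable)
    also have "(\<integral>\<^sup>+\<omega>. ennreal (exp (\<theta> * L \<omega>)) * indicator (space M) \<omega> \<partial>M) = (\<integral>\<^sup>+\<omega>. ennreal (exp (\<theta> * L \<omega>)) \<partial>M)"
      by (intro nn_integral_cong) simp
    also have "ennreal (exp (- \<theta> * t)) * \<dots> \<le> ennreal (exp (- \<theta> * t)) * ennreal (exp (\<theta>\<^sup>2 * \<tau>\<^sup>2 / 2 * V))"
      by (intro mult_left_mono mgf) simp
    also have "\<dots> = ennreal (exp (- \<theta> * t + \<theta>\<^sup>2 * \<tau>\<^sup>2 / 2 * V))"
      by (simp only: exp_add ennreal_mult' exp_ge_zero)
    also have "- \<theta> * t + \<theta>\<^sup>2 * \<tau>\<^sup>2 / 2 * V = - t\<^sup>2 / (2 * V * \<tau>\<^sup>2)"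
      using V \<tau> unfolding \<theta>_def by (simp add: field_simps power2_eq_square)
    finally show ?thesis
      unfolding measure_def L_def[symmetric] by (intro enn2real_leI) auto
  qed
qed

section \<open>Noise of the block model\<close>

abbreviation edges :: "nat \<Rightarrow> (nat \<times> nat) set" where
  "edges n \<equiv> {(i, j). i < j \<and> j < n}"

lemma finite_edges: "finite (edges n)"
  by (rule finite_subset[of _ "{..<n} \<times> {..<n}"]) auto

lemma sum_square_eq_edges:
  fixes f :: "nat \<Rightarrow> nat \<Rightarrow> real"
  shows "(\<Sum>i<n. \<Sum>j<n. f i j) = (\<Sum>(i, j)\<in>edges n. f i j + f j i) + (\<Sum>i<n. f i i)"
proof (induction n)
  case 0
  then show ?case by simp
next
  case (Suc n)
  have "edges (Suc n) = edges n \<union> (\<lambda>i. (i, n)) ` {..<n}" by (auto simp: less_Suc_eq)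
  moreover have "edges n \<inter> (\<lambda>i. (i, n)) ` {..<n} = {}" by auto
  moreover have "inj_on (\<lambda>i. (i, n)) {..<n}" by (auto simp: inj_on_def)
  ultimately have "(\<Sum>(i, j)\<in>edges (Suc n). f i j + f j i)
      = (\<Sum>(i, j)\<in>edges n. f i j + f j i) + (\<Sum>i<n. f i n + f n i)"
    using finite_edges by (simp add: sum.union_disjoint sum.reindex)
  then show ?case using Suc by (simp add: sum.distrib)
qed

definition noise ::
    "real \<Rightarrow> real \<Rightarrow> real vec \<Rightarrow> (nat \<times> nat \<Rightarrow> real) \<Rightarrow> nat \<Rightarrow> nat \<Rightarrow> real" where
  "noise \<mu>1 \<mu>2 \<sigma> \<omega> i j =
     (if i = j then 0 else \<omega> (min i j, max i j) - (if \<sigma> $ i = \<sigma> $ j then \<mu>1 else \<mu>2))"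

lemma noise_sym: "noise \<mu>1 \<mu>2 \<sigma> \<omega> i j = noise \<mu>1 \<mu>2 \<sigma> \<omega> j i"
  unfolding noise_def by (auto simp: min.commute max.commute)

lemma prob_space_SBM:
  assumes "0 < \<tau>"
  shows "prob_space (SBM n \<mu>1 \<mu>2 \<tau> \<sigma>)"
  unfolding SBM_def using assms
  by (intro prob_space_PiM) (auto split: prod.split intro!: prob_space_normal_density)

text \<open>
  A linear form \<open>\<Sum>i j. W i j * b i j\<close> in the symmetric noise matrix has coefficient \<open>b i j + b j i\<close> at
  the independent entry of the edge \<open>{i, j}\<close>.
\<close>

lemma noise_tail:
  fixes \<mu>1 \<mu>2 \<tau> t V :: real and \<sigma> :: "real vec"
  assumes \<tau>: "0 < \<tau>" and t: "0 \<le> t" and V: "0 < V"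
    and b: "(\<Sum>(i, j)\<in>edges n. (b i j + b j i)\<^sup>2) \<le> V"
  defines "M \<equiv> SBM n \<mu>1 \<mu>2 \<tau> \<sigma>"
  shows "{\<omega> \<in> space M. t \<le> (\<Sum>i<n. \<Sum>j<n. noise \<mu>1 \<mu>2 \<sigma> \<omega> i j * b i j)} \<in> sets M"
    and "measure M {\<omega> \<in> space M. t \<le> (\<Sum>i<n. \<Sum>j<n. noise \<mu>1 \<mu>2 \<sigma> \<omega> i j * b i j)}
      \<le> exp (- t\<^sup>2 / (2 * V * \<tau>\<^sup>2))"
proof -
  define \<mu> where "\<mu> = (\<lambda>(i, j). if \<sigma> $ i = \<sigma> $ j then \<mu>1 else \<mu>2)"
  define c where "c = (\<lambda>(i, j). b i j + b j i)"
  have M: "M = (\<Pi>\<^sub>M e\<in>edges n. density lborel (\<lambda>x. ennreal (normal_density (\<mu> e) \<tau> x)))"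
    unfolding M_def SBM_def \<mu>_def by (simp add: case_prod_unfold)
  have "(\<Sum>i<n. \<Sum>j<n. noise \<mu>1 \<mu>2 \<sigma> \<omega> i j * b i j) = (\<Sum>e\<in>edges n. c e * (\<omega> e - \<mu> e))" for \<omega>
    unfolding sum_square_eq_edges
    by (auto simp: noise_def c_def \<mu>_def algebra_simps intro!: sum.cong)
  moreover have "(\<Sum>e\<in>edges n. (c e)\<^sup>2) \<le> V"
    using b by (simp add: c_def case_prod_unfold)
  ultimately show "{\<omega> \<in> space M. t \<le> (\<Sum>i<n. \<Sum>j<n. noise \<mu>1 \<mu>2 \<sigma> \<omega> i j * b i j)} \<in> sets M"
    and "measure M {\<omega> \<in> space M. t \<le> (\<Sum>i<n. \<Sum>j<n. noise \<mu>1 \<mu>2 \<sigma> \<omega> i j * b i j)}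
      \<le> exp (- t\<^sup>2 / (2 * V * \<tau>\<^sup>2))"
    using gaussian_linear_tail[OF finite_edges \<tau> V _ t, of c n \<mu>] unfolding M by simp_all
qed

text \<open>
  The coefficients describe the \<open>k\<close>-th signed row sum of the noise. No edge is met twice by one row,
  so the sum of squares is at most \<open>n\<close> rather than the \<open>2 * n\<close> of a general array with the same
  entries; the threshold \<open>1\<close> for the
  signal-to-noise ratio depends on this constant.
\<close>

lemma row_variance:
  fixes \<sigma> :: "nat \<Rightarrow> real"
  assumes \<sigma>: "\<And>j. j < n \<Longrightarrow> \<sigma> j * \<sigma> j = 1" and k: "k < n"
  defines "b \<equiv> \<lambda>i j. if i = k then - (\<sigma> i * \<sigma> j) else 0"
  shows "(\<Sum>(i, j)\<in>edges n. (b i j + b j i)\<^sup>2) \<le> real n"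
proof -
  have "(\<Sum>(i, j)\<in>edges n. (b i j + b j i)\<^sup>2) = (\<Sum>(i, j)\<in>edges n. (b i j)\<^sup>2 + (b j i)\<^sup>2)"
    by (intro sum.cong) (auto simp: b_def)
  also have "\<dots> \<le> (\<Sum>i<n. \<Sum>j<n. (b i j)\<^sup>2)"
    unfolding sum_square_eq_edges by (simp add: sum_nonneg)
  also have "\<dots> = (\<Sum>i<n. if i = k then \<Sum>j<n. (\<sigma> i * \<sigma> j)\<^sup>2 else 0)"
    unfolding b_def by (intro sum.cong) auto
  also have "\<dots> = (\<Sum>j<n. (\<sigma> k * \<sigma> k) * (\<sigma> j * \<sigma> j))"
    using k by (simp add: power2_eq_square mult_ac)
  also have "\<dots> = real n" using \<sigma> k by simp
  finally show ?thesis .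
qed

lemma outer_product_variance:
  fixes x y :: "nat \<Rightarrow> real"
  shows "(\<Sum>(i, j)\<in>edges n. (x i * y j + x j * y i)\<^sup>2) \<le> 2 * (\<Sum>i<n. (x i)\<^sup>2) * (\<Sum>i<n. (y i)\<^sup>2)"
proof -
  have "(\<Sum>(i, j)\<in>edges n. (x i * y j + x j * y i)\<^sup>2)
      \<le> (\<Sum>(i, j)\<in>edges n. 2 * (x i * y j)\<^sup>2 + 2 * (x j * y i)\<^sup>2)"
  proof (rule sum_mono, clarify)
    fix i j
    have "0 \<le> (x i * y j - x j * y i)\<^sup>2" by simp
    then show "(x i * y j + x j * y i)\<^sup>2 \<le> 2 * (x i * y j)\<^sup>2 + 2 * (x j * y i)\<^sup>2"
      by (simp add: power2_eq_square algebra_simps)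
  qed
  also have "\<dots> \<le> (\<Sum>i<n. \<Sum>j<n. 2 * (x i * y j)\<^sup>2)"
    unfolding sum_square_eq_edges by (simp add: sum_nonneg)
  also have "\<dots> = 2 * (\<Sum>i<n. (x i)\<^sup>2) * (\<Sum>i<n. (y i)\<^sup>2)"
    unfolding mult.assoc sum_product by (simp add: power_mult_distrib sum_distrib_left)
  finally show ?thesis .
qed

section \<open>Deterministic recovery\<close>

lemma mat_inner_eq:
  assumes "X \<in> carrier_mat n n" "Y \<in> carrier_mat n n"
  shows "mat_inner X Y = (\<Sum>i<n. \<Sum>j<n. X $$ (i, j) * Y $$ (i, j))"
proof -
  have "mat_inner X Y = (\<Sum>j<n. \<Sum>i<n. X $$ (i, j) * Y $$ (i, j))"
    using assms by (auto simp: mat_inner_def mat_trace_def scalar_prod_def atLeast0LessThan intro!: sum.cong)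
  also have "\<dots> = (\<Sum>i<n. \<Sum>j<n. X $$ (i, j) * Y $$ (i, j))" by (rule sum.swap)
  finally show ?thesis .
qed

lemma pos_semidef_bilinear_form:
  assumes "pos_semidef n Y"
  shows "0 \<le> bilinear_form n (\<lambda>i j. Y $$ (i, j)) x x"
proof -
  have "0 \<le> vec n x \<bullet> (Y *\<^sub>v vec n x)" using assms by (simp add: pos_semidef_def)
  also have "\<dots> = (\<Sum>i<n. x i * (\<Sum>j<n. Y $$ (i, j) * x j))"
    using assms
    by (auto simp: pos_semidef_def scalar_prod_def atLeast0LessThan intro!: sum.cong)
  also have "\<dots> = bilinear_form n (\<lambda>i j. Y $$ (i, j)) x x"
    by (simp add: bilinear_form_def sum_distrib_left mult_ac)
  finally show ?thesis .
qed

lemma balanced_labelingsD: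
  assumes "\<sigma> \<in> balanced_labelings n"
  shows "dim_vec \<sigma> = n" "i < n \<Longrightarrow> \<sigma> $ i = -1 \<or> \<sigma> $ i = 1" "i < n \<Longrightarrow> \<sigma> $ i * \<sigma> $ i = 1"
    "(\<Sum>i<n. \<sigma> $ i) = 0"
  using assms by (auto simp: balanced_labelings_def)

lemma label_matrix_feasible:
  assumes \<sigma>: "\<sigma> \<in> balanced_labelings n"
  shows "sdp_feasible n (label_matrix \<sigma>)"
proof -
  note D = balanced_labelingsD[OF \<sigma>]
  have carrier: "label_matrix \<sigma> \<in> carrier_mat n n" by (simp add: label_matrix_def D)
  have entry: "label_matrix \<sigma> $$ (i, j) = \<sigma> $ i * \<sigma> $ j" if "i < n" "j < n" for i j
    using that by (simp add: label_matrix_def D)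
  have "symmetric_mat (label_matrix \<sigma>)"
    unfolding symmetric_mat_def by (rule eq_matI) (auto simp: label_matrix_def)
  moreover have "0 \<le> v \<bullet> (label_matrix \<sigma> *\<^sub>v v)" if v: "v \<in> carrier_vec n" for v
  proof -
    have "v \<bullet> (label_matrix \<sigma> *\<^sub>v v) = (\<Sum>i<n. v $ i * (\<Sum>j<n. \<sigma> $ i * \<sigma> $ j * v $ j))"
      using v carrier by (auto simp: scalar_prod_def atLeast0LessThan entry intro!: sum.cong)
    also have "\<dots> = (\<Sum>i<n. \<sigma> $ i * v $ i)\<^sup>2"
      by (simp add: power2_eq_square sum_product sum_distrib_left mult_ac)
    finally show ?thesis by simp
  qed
  moreover have "mat_inner (all_ones_mat n) (label_matrix \<sigma>) = 0"
  proof -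
    have "mat_inner (all_ones_mat n) (label_matrix \<sigma>) = (\<Sum>i<n. \<Sum>j<n. \<sigma> $ i * \<sigma> $ j)"
      using carrier by (subst mat_inner_eq[of _ n]) (auto simp: all_ones_mat_def entry intro!: sum.cong)
    also have "\<dots> = 0" by (simp add: sum_distrib_left[symmetric] D)
    finally show ?thesis .
  qed
  ultimately show ?thesis
    using carrier by (simp add: sdp_feasible_def pos_semidef_def entry D)
qed

text \<open>
  The expected adjacency matrix is \<open>m + h * \<sigma> i * \<sigma> j\<close> with \<open>m = (\<mu>1 + \<mu>2) / 2\<close> and
  \<open>h = (\<mu>1 - \<mu>2) / 2\<close>, except on the diagonal, where \<open>m + h = \<mu>1\<close> has to be removed.
\<close>

lemma sdp_recovers:
  assumes sdp: "sdp_estimator Yhat" and n: "even n" "0 < n" and \<sigma>: "\<sigma> \<in> balanced_labelings n"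
    and row: "\<And>i. i < n \<Longrightarrow> - (\<Sum>j<n. noise \<mu>1 \<mu>2 \<sigma> \<omega> i j * (\<sigma> $ i * \<sigma> $ j)) \<le> a"
    and norm: "\<And>x. bilinear_form n (noise \<mu>1 \<mu>2 \<sigma> \<omega>) x x \<le> b * (\<Sum>i<n. (x i)\<^sup>2)"
    and gap: "a + b < real n * ((\<mu>1 - \<mu>2) / 2)"
  shows "Yhat n (adjacency_matrix n \<omega>) = label_matrix \<sigma>"
proof -
  note D = balanced_labelingsD[OF \<sigma>]
  define A where "A = adjacency_matrix n \<omega>"
  define Y where "Y = Yhat n A"
  have A: "A \<in> carrier_mat n n" by (simp add: A_def adjacency_matrix_def)
  have "symmetric_mat A"
    unfolding symmetric_mat_def A_def adjacency_matrix_def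
    by (rule eq_matI) (auto simp: min.commute max.commute)
  then have "is_arg_max (mat_inner A) (sdp_feasible n) Y"
    using sdp n A unfolding sdp_estimator_def Y_def by blast
  then have feas: "sdp_feasible n Y" and max: "mat_inner A (label_matrix \<sigma>) \<le> mat_inner A Y"
    using label_matrix_feasible[OF \<sigma>] by (auto simp: is_arg_max_def not_less)
  have Y: "Y \<in> carrier_mat n n" "pos_semidef n Y" "symmetric_mat Y" "\<And>i. i < n \<Longrightarrow> Y $$ (i, i) = 1"
    "mat_inner (all_ones_mat n) Y = 0"
    using feas by (auto simp: sdp_feasible_def pos_semidef_def)
  have L: "label_matrix \<sigma> \<in> carrier_mat n n" by (simp add: label_matrix_def D)
  have "Y $$ (i, j) = \<sigma> $ i * \<sigma> $ j" if ij: "i < n" "j < n" for i j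
  proof (rule dual_certificate[where \<sigma> = "\<lambda>i. \<sigma> $ i" and A = "\<lambda>i j. A $$ (i, j)" and m = "(\<mu>1 + \<mu>2) / 2"
        and h = "(\<mu>1 - \<mu>2) / 2" and W = "noise \<mu>1 \<mu>2 \<sigma> \<omega>" and Y = "\<lambda>i j. Y $$ (i, j)",
        OF n(2) D(3,4) _ noise_sym row norm gap])
    show "A $$ (i, j) = (\<mu>1 + \<mu>2) / 2 + (\<mu>1 - \<mu>2) / 2 * (\<sigma> $ i * \<sigma> $ j) + noise \<mu>1 \<mu>2 \<sigma> \<omega> i j
        - (if i = j then (\<mu>1 + \<mu>2) / 2 + (\<mu>1 - \<mu>2) / 2 else 0)" if "i < n" "j < n" for i j
      using that D(2)[of i] D(2)[of j]
      by (auto simp: A_def adjacency_matrix_def noise_def field_simps)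
    show "Y $$ (i, j) = Y $$ (j, i)" if "i < n" "j < n" for i j
      using that Y(1,3) unfolding symmetric_mat_def by (metis carrier_matD index_transpose_mat(1))
    show "0 \<le> bilinear_form n (\<lambda>i j. Y $$ (i, j)) x x" for x
      by (rule pos_semidef_bilinear_form[OF Y(2)])
    show "Y $$ (i, i) = 1" if "i < n" for i using that by (rule Y(4))
    have "mat_inner (all_ones_mat n) Y = (\<Sum>i<n. \<Sum>j<n. Y $$ (i, j))"
      using Y(1) by (subst mat_inner_eq[of _ n]) (auto simp: all_ones_mat_def)
    then show "(\<Sum>i<n. \<Sum>j<n. Y $$ (i, j)) = 0" using Y(5) by simp
    have "mat_inner A (label_matrix \<sigma>) = (\<Sum>i<n. \<Sum>j<n. A $$ (i, j) * (\<sigma> $ i * \<sigma> $ j))"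
      unfolding mat_inner_eq[OF A L] by (intro sum.cong) (auto simp: label_matrix_def D)
    then show "(\<Sum>i<n. \<Sum>j<n. A $$ (i, j) * (\<sigma> $ i * \<sigma> $ j)) \<le> (\<Sum>i<n. \<Sum>j<n. A $$ (i, j) * Y $$ (i, j))"
      using max mat_inner_eq[OF A Y(1)] by simp
  qed (use ij in auto)
  then have "Y = label_matrix \<sigma>"
    using Y(1) by (intro eq_matI) (auto simp: label_matrix_def D)
  then show ?thesis unfolding Y_def A_def .
qed

section \<open>Probability of recovery\<close>

lemma finite_balanced_labelings: "finite (balanced_labelings n)"
proof (rule finite_subset)
  show "balanced_labelings n \<subseteq> vec n ` ({..<n} \<rightarrow>\<^sub>E {-1, 1})"
  proof
    fix \<sigma> assume "\<sigma> \<in> balanced_labelings n"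
    note D = balanced_labelingsD[OF this]
    have "\<sigma> = vec n (restrict (\<lambda>i. \<sigma> $ i) {..<n})" by (rule eq_vecI) (auto simp: D)
    moreover have "restrict (\<lambda>i. \<sigma> $ i) {..<n} \<in> {..<n} \<rightarrow>\<^sub>E {-1, 1}" using D(2) by auto
    ultimately show "\<sigma> \<in> vec n ` ({..<n} \<rightarrow>\<^sub>E {-1, 1})" by blast
  qed
qed (auto intro!: finite_imageI finite_PiE)

lemma balanced_labelings_nonempty:
  assumes "even n"
  shows "balanced_labelings n \<noteq> {}"
proof -
  obtain k where k: "n = 2 * k" using assms by blast
  have "(\<Sum>i<2 * k. if even i then 1 else -1 :: real) = 0" by (induction k) auto
  then have "vec n (\<lambda>i. if even i then 1 else -1) \<in> balanced_labelings n"
    by (auto simp: balanced_labelings_def k)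
  then show ?thesis by blast
qed

text \<open>
  Union bound over the \<open>n\<close> signed row sums, which must stay below \<open>\<gamma>\<close>, and the pairs of net points,
  which control the noise form by \<open>\<eta>\<close>.
\<close>

lemma recovery_probability_ge:
  fixes \<mu>1 \<mu>2 \<tau> \<gamma> \<eta> :: real and \<sigma> :: "real vec"
  assumes \<tau>: "0 < \<tau>" and sdp: "sdp_estimator Yhat" and n: "even n" "0 < n"
    and \<sigma>: "\<sigma> \<in> balanced_labelings n"
    and nonneg: "0 \<le> \<gamma>" "0 \<le> \<eta>"
    and gap: "\<gamma> + \<eta> < real n * ((\<mu>1 - \<mu>2) / 2)"
  defines "M \<equiv> SBM n \<mu>1 \<mu>2 \<tau> \<sigma>"
  assumes event: "recovery_event Yhat n (label_matrix \<sigma>) M \<in> sets M"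
  shows "1 - (real n * exp (- \<gamma>\<^sup>2 / (2 * real n * \<tau>\<^sup>2)) + (48 ^ n)\<^sup>2 * exp (- \<eta>\<^sup>2 / (16 * \<tau>\<^sup>2)))
    \<le> measure M (recovery_event Yhat n (label_matrix \<sigma>) M)"
proof -
  interpret prob_space M unfolding M_def by (rule prob_space_SBM[OF \<tau>])
  note D = balanced_labelingsD[OF \<sigma>]
  let ?W = "noise \<mu>1 \<mu>2 \<sigma>"
  let ?R = "recovery_event Yhat n (label_matrix \<sigma>) M"
  \<comment> \<open>The net bounds the form by \<open>T / (8 * n)\<close>, which is to equal \<open>\<eta>\<close>.\<close>
  define T where "T = 8 * real n * \<eta>"
  define row_coeff where "row_coeff k = (\<lambda>i j. if i = k then - (\<sigma> $ i * \<sigma> $ j) else 0)" for k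
  define row_bad where "row_bad k = {\<omega> \<in> space M. \<gamma> \<le> (\<Sum>i<n. \<Sum>j<n. ?W \<omega> i j * row_coeff k i j)}" for k
  define net_coeff where
    "net_coeff p = (\<lambda>i j. real_of_int (fst p i) * real_of_int (snd p j))" for p :: "(nat \<Rightarrow> int) \<times> (nat \<Rightarrow> int)"
  define net_bad where "net_bad p = {\<omega> \<in> space M. T \<le> (\<Sum>i<n. \<Sum>j<n. ?W \<omega> i j * net_coeff p i j)}" for p
  have row: "row_bad k \<in> sets M" "measure M (row_bad k) \<le> exp (- \<gamma>\<^sup>2 / (2 * real n * \<tau>\<^sup>2))"
    if k: "k < n" for k
  proof -
    have n0: "0 < real n" using n(2) by simp
    note tail = noise_tail[OF \<tau> nonneg(1) n0 row_variance[of n "\<lambda>j. \<sigma> $ j", OF D(3) k]]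
    show "row_bad k \<in> sets M"
      unfolding row_bad_def row_coeff_def M_def by (rule tail(1))
    show "measure M (row_bad k) \<le> exp (- \<gamma>\<^sup>2 / (2 * real n * \<tau>\<^sup>2))"
      unfolding row_bad_def row_coeff_def M_def by (rule tail(2))
  qed
  have net: "net_bad p \<in> sets M" "measure M (net_bad p) \<le> exp (- \<eta>\<^sup>2 / (16 * \<tau>\<^sup>2))"
    if p: "p \<in> ball_net n \<times> ball_net n" for p
  proof -
    let ?x = "\<lambda>i. real_of_int (fst p i)" and ?y = "\<lambda>i. real_of_int (snd p i)"
    \<comment> \<open>The variance proxy 512 is \<open>2 * 16 * 16\<close>, from the Euclidean bound in \<open>ball_net\<close>.\<close>
    have "(\<Sum>i<n. (?x i)\<^sup>2) \<le> 16 * real n" "(\<Sum>i<n. (?y i)\<^sup>2) \<le> 16 * real n"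
      using p by (simp_all add: ball_net_def mem_Times_iff)
    then have "(\<Sum>i<n. (?x i)\<^sup>2) * (\<Sum>i<n. (?y i)\<^sup>2) \<le> (16 * real n) * (16 * real n)"
      by (rule mult_mono) (simp_all add: sum_nonneg)
    then have "2 * (\<Sum>i<n. (?x i)\<^sup>2) * (\<Sum>i<n. (?y i)\<^sup>2) \<le> 512 * (real n)\<^sup>2"
      unfolding power2_eq_square[of "real n"] by linarith
    with outer_product_variance[of ?x ?y n]
    have "(\<Sum>(i, j)\<in>edges n. (?x i * ?y j + ?x j * ?y i)\<^sup>2) \<le> 512 * (real n)\<^sup>2"
      by (rule order_trans)
    then have var: "(\<Sum>(i, j)\<in>edges n. (net_coeff p i j + net_coeff p j i)\<^sup>2) \<le> 512 * (real n)\<^sup>2"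
      unfolding net_coeff_def .
    have T: "0 \<le> T" "0 < 512 * (real n)\<^sup>2" using nonneg n(2) by (auto simp: T_def)
    show "net_bad p \<in> sets M"
      unfolding net_bad_def M_def by (rule noise_tail(1)[OF \<tau> T var])
    have "measure M (net_bad p) \<le> exp (- T\<^sup>2 / (2 * (512 * (real n)\<^sup>2) * \<tau>\<^sup>2))"
      unfolding net_bad_def M_def by (rule noise_tail(2)[OF \<tau> T var])
    also have "- T\<^sup>2 / (2 * (512 * (real n)\<^sup>2) * \<tau>\<^sup>2) = - \<eta>\<^sup>2 / (16 * \<tau>\<^sup>2)"
      using n(2) \<tau> by (simp add: T_def field_simps power2_eq_square)
    finally show "measure M (net_bad p) \<le> exp (- \<eta>\<^sup>2 / (16 * \<tau>\<^sup>2))" .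
  qed
  have good: "\<omega> \<in> ?R" if \<omega>: "\<omega> \<in> space M" "\<And>k. k < n \<Longrightarrow> \<omega> \<notin> row_bad k"
    "\<And>p. p \<in> ball_net n \<times> ball_net n \<Longrightarrow> \<omega> \<notin> net_bad p" for \<omega>
  proof -
    have "Yhat n (adjacency_matrix n \<omega>) = label_matrix \<sigma>"
    proof (rule sdp_recovers[OF sdp n \<sigma> _ _ gap])
      fix k assume k: "k < n"
      have "(\<Sum>i<n. \<Sum>j<n. ?W \<omega> i j * row_coeff k i j)
         = (\<Sum>i<n. if i = k then \<Sum>j<n. - (?W \<omega> i j * (\<sigma> $ i * \<sigma> $ j)) else 0)"
        unfolding row_coeff_def by (intro sum.cong) auto
      also have "\<dots> = - (\<Sum>j<n. ?W \<omega> k j * (\<sigma> $ k * \<sigma> $ j))"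
        using k by (simp add: sum_negf)
      finally show "- (\<Sum>j<n. ?W \<omega> k j * (\<sigma> $ k * \<sigma> $ j)) \<le> \<gamma>"
        using \<omega>(1) \<omega>(2)[OF k] by (simp add: row_bad_def)
    next
      fix x
      have "bilinear_form n (?W \<omega>) (\<lambda>i. real_of_int (z i)) (\<lambda>i. real_of_int (w i)) \<le> T"
        if "z \<in> ball_net n" "w \<in> ball_net n" for z w
        using \<omega>(1) \<omega>(3)[of "(z, w)"] that
        by (simp add: net_bad_def net_coeff_def bilinear_form_def mult_ac)
      then have "bilinear_form n (?W \<omega>) x x \<le> T / (8 * real n) * (\<Sum>i<n. (x i)\<^sup>2)"
        by (rule bilinear_form_le_of_net[OF n(2)])
      also have "T / (8 * real n) = \<eta>" using n(2) by (simp add: T_def)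
      finally show "bilinear_form n (?W \<omega>) x x \<le> \<eta> * (\<Sum>i<n. (x i)\<^sup>2)" .
    qed
    then show ?thesis using \<omega>(1) by (simp add: recovery_event_def)
  qed
  have "space M - ?R \<subseteq> (\<Union>k\<in>{..<n}. row_bad k) \<union> (\<Union>p\<in>ball_net n \<times> ball_net n. net_bad p)"
    using good by blast
  then have "prob (space M - ?R) \<le> prob ((\<Union>k\<in>{..<n}. row_bad k) \<union> (\<Union>p\<in>ball_net n \<times> ball_net n. net_bad p))"
    using row(1) net(1) finite_net by (intro finite_measure_mono sets.Un sets.finite_UN) auto
  also have "\<dots> \<le> prob (\<Union>k\<in>{..<n}. row_bad k) + prob (\<Union>p\<in>ball_net n \<times> ball_net n. net_bad p)"
    using row(1) net(1) finite_net by (intro measure_Un_le sets.finite_UN) auto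
  also have "prob (\<Union>k\<in>{..<n}. row_bad k) \<le> (\<Sum>k\<in>{..<n}. prob (row_bad k))"
    using row(1) by (intro measure_UNION_le) auto
  also have "\<dots> \<le> (\<Sum>k\<in>{..<n}. exp (- \<gamma>\<^sup>2 / (2 * real n * \<tau>\<^sup>2)))"
    using row(2) by (intro sum_mono) auto
  also have "\<dots> = real n * exp (- \<gamma>\<^sup>2 / (2 * real n * \<tau>\<^sup>2))" by simp
  also have "prob (\<Union>p\<in>ball_net n \<times> ball_net n. net_bad p) \<le> (\<Sum>p\<in>ball_net n \<times> ball_net n. prob (net_bad p))"
    using net(1) finite_net by (intro measure_UNION_le) auto
  also have "\<dots> \<le> (\<Sum>p\<in>ball_net n \<times> ball_net n. exp (- \<eta>\<^sup>2 / (16 * \<tau>\<^sup>2)))"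
    using net(2) by (intro sum_mono) auto
  also have "\<dots> = (real (card (ball_net n)))\<^sup>2 * exp (- \<eta>\<^sup>2 / (16 * \<tau>\<^sup>2))"
    by (simp add: card_cartesian_product power2_eq_square)
  also have "\<dots> \<le> (48 ^ n)\<^sup>2 * exp (- \<eta>\<^sup>2 / (16 * \<tau>\<^sup>2))"
    using card_net[of n] by (intro mult_right_mono power_mono) auto
  finally have "prob (space M - ?R) \<le> real n * exp (- \<gamma>\<^sup>2 / (2 * real n * \<tau>\<^sup>2))
      + (48 ^ n)\<^sup>2 * exp (- \<eta>\<^sup>2 / (16 * \<tau>\<^sup>2))" by simp
  then show ?thesis using prob_compl[OF event] by simp
qed

lemma failure_bound_tendsto_0:
  fixes \<kappa> c :: real
  assumes "1 < \<kappa>" "0 < c"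
  shows "(\<lambda>n. real n * exp (- (\<kappa> * ln (real n))) + (48 ^ n)\<^sup>2 * exp (- (c * (real n * ln (real n))))) \<longlonglongrightarrow> 0"
proof -
  have "(\<lambda>n. real n * exp (- (\<kappa> * ln (real n)))) \<longlonglongrightarrow> 0"
    using assms(1) by real_asymp
  moreover have "(\<lambda>n. (48 ^ n)\<^sup>2 * exp (- (c * (real n * ln (real n))))) \<longlonglongrightarrow> 0"
    using assms(2) by real_asymp
  ultimately show ?thesis by (rule tendsto_add_zero)
qed

theorem theorem13:
  fixes \<alpha> \<beta> \<tau> :: real
    and Yhat :: "nat \<Rightarrow> real mat \<Rightarrow> real mat"
    and G :: "nat \<Rightarrow> real vec \<Rightarrow> (nat \<times> nat \<Rightarrow> real) measure"
  defines "G \<equiv> \<lambda>n. SBM n (\<alpha> * sqrt (ln (real n) / real n)) (\<beta> * sqrt (ln (real n) / real n)) \<tau>"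
  assumes "\<alpha> > \<beta>" and "\<tau> > 0"
    and SNR: "(\<alpha> - \<beta>)\<^sup>2 / (8 * \<tau>\<^sup>2) > 1"
    and sdp: "sdp_estimator Yhat"
    and event: "\<And>n \<sigma>. even n \<Longrightarrow> \<sigma> \<in> balanced_labelings n \<Longrightarrow>
      recovery_event Yhat n (label_matrix \<sigma>) (G n \<sigma>) \<in> sets (G n \<sigma>)"
  shows "((\<lambda>n. Min {measure (G n \<sigma>) (recovery_event Yhat n Y (G n \<sigma>)) | \<sigma> Y.
              Y \<in> label_matrices n \<and> \<sigma> \<in> balanced_labelings n \<and> Y = label_matrix \<sigma>})
          \<longlongrightarrow> 1) (inf sequentially (principal {n. even n}))"
proof -
  define p where "p n \<sigma> = measure (G n \<sigma>) (recovery_event Yhat n (label_matrix \<sigma>) (G n \<sigma>))" for n \<sigma>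
  have set_eq: "{measure (G n \<sigma>) (recovery_event Yhat n Y (G n \<sigma>)) | \<sigma> Y.
      Y \<in> label_matrices n \<and> \<sigma> \<in> balanced_labelings n \<and> Y = label_matrix \<sigma>} = p n ` balanced_labelings n" for n
    by (auto simp: p_def label_matrices_def)
  \<comment> \<open>The slack in the condition on the signal-to-noise ratio; one third of it goes to \<open>\<gamma>\<close>, one
    third to \<open>\<eta>\<close>, and the last third keeps the inequality \<open>gap\<close> below strict.\<close>
  define \<Delta> where "\<Delta> = (\<alpha> - \<beta>) / 2 - sqrt 2 * \<tau>"
  have "(sqrt 2 * \<tau>)\<^sup>2 < ((\<alpha> - \<beta>) / 2)\<^sup>2"
    using SNR \<open>\<tau> > 0\<close> by (simp add: field_simps power_mult_distrib)
  then have "sqrt 2 * \<tau> < (\<alpha> - \<beta>) / 2"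
    by (rule power2_less_imp_less) (use \<open>\<alpha> > \<beta>\<close> in simp)
  then have \<Delta>: "0 < \<Delta>" unfolding \<Delta>_def by simp
  define \<gamma> where "\<gamma> = sqrt 2 * \<tau> + \<Delta> / 3"
  define \<eta> where "\<eta> = \<Delta> / 3"
  have \<gamma>: "sqrt 2 * \<tau> < \<gamma>" and \<eta>: "0 < \<eta>" using \<Delta> by (auto simp: \<gamma>_def \<eta>_def)
  have \<gamma>0: "0 < \<gamma>" using \<gamma> \<open>\<tau> > 0\<close> by (smt (verit) mult_pos_pos real_sqrt_gt_zero)
  define \<kappa> where "\<kappa> = \<gamma>\<^sup>2 / (2 * \<tau>\<^sup>2)"
  define c where "c = \<eta>\<^sup>2 / (16 * \<tau>\<^sup>2)"
  have "(sqrt 2 * \<tau>)\<^sup>2 < \<gamma>\<^sup>2" using \<gamma> \<open>\<tau> > 0\<close> by (intro power_strict_mono) auto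
  then have \<kappa>: "1 < \<kappa>" using \<open>\<tau> > 0\<close> by (simp add: \<kappa>_def power_mult_distrib)
  have c: "0 < c" using \<eta> \<open>\<tau> > 0\<close> by (simp add: c_def)
  define err where
    "err n = real n * exp (- (\<kappa> * ln (real n))) + (48 ^ n)\<^sup>2 * exp (- (c * (real n * ln (real n))))" for n
  have lower: "1 - err n \<le> p n \<sigma>" if n: "even n" "1 < n" and \<sigma>: "\<sigma> \<in> balanced_labelings n" for n \<sigma>
  proof -
    define s where "s = sqrt (real n * ln (real n))"
    have s: "0 < s" "s\<^sup>2 = real n * ln (real n)" using n(2) by (auto simp: s_def)
    have "s / real n = sqrt (ln (real n) / real n)"
      using n(2) by (simp add: s_def real_sqrt_mult real_sqrt_divide field_simps)
    then have ns: "real n * sqrt (ln (real n) / real n) = s" using n(2) by (simp add: field_simps)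
    have "\<gamma> + \<eta> = (\<alpha> - \<beta>) / 2 - \<Delta> / 3"
      unfolding \<gamma>_def \<eta>_def using \<Delta>_def by linarith
    then have "\<gamma> * s + \<eta> * s = ((\<alpha> - \<beta>) / 2 - \<Delta> / 3) * s"
      by (simp add: distrib_right[symmetric])
    also have "\<dots> < (\<alpha> - \<beta>) / 2 * s" using \<Delta> s by (intro mult_strict_right_mono) linarith+
    also have "\<dots> = real n * ((\<alpha> * sqrt (ln (real n) / real n) - \<beta> * sqrt (ln (real n) / real n)) / 2)"
      unfolding ns[symmetric] by (simp add: algebra_simps)
    finally have gap: "\<gamma> * s + \<eta> * s
        < real n * ((\<alpha> * sqrt (ln (real n) / real n) - \<beta> * sqrt (ln (real n) / real n)) / 2)" .
    have "1 - (real n * exp (- (\<gamma> * s)\<^sup>2 / (2 * real n * \<tau>\<^sup>2)) + (48 ^ n)\<^sup>2 * exp (- (\<eta> * s)\<^sup>2 / (16 * \<tau>\<^sup>2)))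
        \<le> p n \<sigma>"
      unfolding p_def G_def
    proof (rule recovery_probability_ge[OF \<open>\<tau> > 0\<close> sdp n(1) _ \<sigma> _ _ gap])
      show "0 < n" using n(2) by simp
      show "0 \<le> \<gamma> * s" "0 \<le> \<eta> * s" using \<gamma>0 \<eta> s by simp_all
    qed (rule event[OF n(1) \<sigma>, unfolded G_def])
    moreover have "- (\<gamma> * s)\<^sup>2 / (2 * real n * \<tau>\<^sup>2) = - (\<kappa> * ln (real n))"
      using n(2) \<open>\<tau> > 0\<close> by (simp add: power_mult_distrib s \<kappa>_def)
    moreover have "- (\<eta> * s)\<^sup>2 / (16 * \<tau>\<^sup>2) = - (c * (real n * ln (real n)))"
      by (simp add: power_mult_distrib s c_def)
    ultimately show ?thesis unfolding err_def by simp
  qed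
  have upper: "p n \<sigma> \<le> 1" for n \<sigma>
    unfolding p_def G_def by (rule prob_space.prob_le_1[OF prob_space_SBM[OF \<open>\<tau> > 0\<close>]])
  have "err \<longlonglongrightarrow> 0" unfolding err_def by (rule failure_bound_tendsto_0[OF \<kappa> c])
  then have "(\<lambda>n. 1 - err n) \<longlonglongrightarrow> 1 - 0" by (intro tendsto_intros)
  then have lim: "((\<lambda>n. 1 - err n) \<longlongrightarrow> 1) (inf sequentially (principal {n. even n}))"
    by (simp add: tendsto_mono[OF inf_le1])
  have "\<forall>\<^sub>F n in inf sequentially (principal {n. even n}).
      1 - err n \<le> Min (p n ` balanced_labelings n) \<and> Min (p n ` balanced_labelings n) \<le> 1"
    (is "\<forall>\<^sub>F n in ?F. ?lower n \<and> ?upper n")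
    unfolding eventually_inf_principal
  proof (rule eventually_mono[OF eventually_gt_at_top[of 1]], clarify)
    fix n :: nat assume n: "1 < n" "even n"
    have ne: "p n ` balanced_labelings n \<noteq> {}" "finite (p n ` balanced_labelings n)"
      using balanced_labelings_nonempty[OF n(2)] finite_balanced_labelings by auto
    obtain \<sigma> where "\<sigma> \<in> balanced_labelings n" using balanced_labelings_nonempty[OF n(2)] by blast
    then have "Min (p n ` balanced_labelings n) \<le> p n \<sigma>" using ne by simp
    then show "1 - err n \<le> Min (p n ` balanced_labelings n) \<and> Min (p n ` balanced_labelings n) \<le> 1"
      using ne lower[OF n(2,1)] upper[of n \<sigma>] by (auto simp: Min_ge_iff)
  qed
  then have "eventually ?lower ?F" "eventually ?upper ?F"
    by (simp_all add: eventually_conj_iff)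
  then show ?thesis
    unfolding set_eq by (rule tendsto_sandwich[OF _ _ lim tendsto_const])
qed

end
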